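(* For any self-similar action $(G,E)$ we have $$E^{\le\infty}\setminus\widetilde{\mathcal G}(G,E)_{\mathrm H}=\partial E\setminus\mathcal G(G,E)_{\mathrm H},$$ and a path $\mu$ is in this set if and only if it admits a singular decomposition. More precisely, for every $\mu\in\partial E$ we have $$\overline X(\mu)=\{\mu\}\cup\{[\alpha,g,\alpha;\mu]:(\alpha,g)\text{ is a singular decomposition of }\mu\},$$ and the cardinality of $\overline X(\mu)$ equals the cardinality of the set of equivalence classes of singular decompositions of $\mu$ plus one.
   Context: A directed graph $E=(E^0,E^1,r,s)$ has vertices $E^0$, edges $E^1$, and maps $r,s:E^1\to E^0$. For $n\ge1$, $E^n$ is the set of paths $\mu=\mu_1\cdots\mu_n$ ($\mu_i\in E^1$, $s(\mu_i)=r(\mu_{i+1})$), $r(\mu)=r(\mu_1)$, $s(\mu)=s(\mu_n)$, $|\mu|=n$; vertices are paths of length $0$ with $r(v)=s(v)=v$; $E^*=\bigcup_{n\ge0}E^n$; $E^\infty$ is the set of infinite paths; $vE^n,vE^*$ denote paths with range $v$. $\alpha$ extends $\beta$ ($\beta$ is a prefix of $\alpha$) if $\alpha=\beta\beta'$; two paths are comparable if one of them is a prefix of the other. A vertex $v$ is singular if $vE^1$ is empty or infinite. $(G,E)$ is a self-similar action if $G$ is a discrete groupoid with $G^0=E^0$, equipped with a left action $(g,e)\mapsto ge$ on $E^1$ (defined when $s(g)=r(e)$, with $r(ge)=r(g)$, $(hg)e=h(ge)$, $r(e)e=e$) and a map $(g,e)\mapsto g|_e\in G$ with $(hg)|_e=h|_{ge}\,g|_e$,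 $s(g|_e)=s(e)$, $r(g|_e)=s(ge)$. It extends to paths by $g\,s(g)=r(g)$, $g|_{s(g)}=g$, $g(e\mu)=(ge)(g|_e\mu)$, $g|_{e\mu}=(g|_e)|_\mu$, and to infinite paths by $g(\mu_1\mu_2\cdots)=(g\mu_1)(g|_{\mu_1}\mu_2)(g|_{\mu_1\mu_2}\mu_3)\cdots$. A finite path $\mu\in s(g)E^*$ is strongly $g$-fixed if $g\mu=\mu$ and $g|_\mu=s(\mu)$; an infinite path is strongly $g$-fixed if it has a strongly $g$-fixed finite prefix. $E^{\le\infty}=E^*\cup E^\infty$; $Z(\alpha)$ is the set of elements of $E^{\le\infty}$ with prefix $\alpha$; the sets $Z(\alpha)\setminus\bigcup_{\beta\in F}Z(\alpha\beta)$ ($F\subseteq s(\alpha)E^*$ finite) form a basis of the topology. $\partial E=E^\infty\cup\{\mu\in E^*:s(\mu)\text{ singular}\}$. $\widetilde{\mathcal G}(G,E)$ consists of classes $[\alpha,g,\beta;\xi]$, where $\alpha,\beta\in E^*$, $g\in G$, $r(g)=s(\alpha)$, $s(g)=s(\beta)$, $\xi\in Z(\beta)$, and $[\alpha,g,\beta;\xi]=[\gamma,h,\delta;\eta]$ iff $\xi=\eta$ and there are $\beta',\delta'\in E^*$ with $\beta\beta'=\delta\delta'$ a prefix of $\xi$, $\alpha(g\beta')=\gamma(h\delta')$ and $g|_{\beta'}=h|_{\delta'}$. The source of $[\alpha,g,\beta;\beta\xi]$ is $\beta\xi$, its range is $\alpha(g\xi)$; $\xi\in E^{\le\infty}$ is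 identified with the unit $[r(\xi),r(\xi),r(\xi);\xi]$, so the unit space is $E^{\le\infty}$; basic open sets are $\{[\alpha,g,\beta;\xi]:\xi\in V\}$, $V\subseteq Z(\beta)$ open. $\mathcal G(G,E)$ is its restriction to $\partial E$, with unit space $\partial E$. For a topological groupoid $\mathcal H$, $\mathcal H_{\mathrm H}$ is the set of points that can be separated by disjoint open sets from every other point of $\mathcal H$. For $\mu\in\partial E$, $\overline X(\mu)$ is the set of elements of $\mathcal G(G,E)$ with range and source $\mu$ that lie in the closure of $\partial E$ in $\mathcal G(G,E)$. Singular decompositions, infinite paths. A singular decomposition of $\mu\in E^\infty$ is a pair $(\alpha,g)$, $\alpha\in E^*$, $g\in G$, $s(\alpha)=r(g)$, such that $\mu=\alpha\xi$ where $\xi$ is not strongly $g$-fixed but every finite prefix of $\xi$ has a strongly $g$-fixed extension. Two singular decompositions $(\alpha,g)$ and $(\beta,h)$ of $\mu\in E^\infty$ are equivalent if there is a prefix $\gamma$ of $\mu$ such that $\gamma=\alpha\alpha'=\beta\beta'$ and $g|_{\alpha'}=h|_{\beta'}$. Singular decompositions, finite paths. A singular decomposition of $\mu\in E^*$ is a pair $(\alpha,g)$, $\alpha\in E^*$, $g\in G$, $s(\alpha)=r(g)$, such that $\mu=\alpha\xi$ and $\xi$ is not strongly $g$-fixed, but there is an infinite set $I\subseteq s(\mu)E^1$ such that each $\xi e$, $e\in I$, has a strongly $g$-fixed extension. Two singular decompositions $(\alpha,g)$ and $(\beta,h)$ of $\mu\in E^*$ are equivalent if there is a common extension $\alpha\alpha'=\beta\beta'$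 of $\alpha$ and $\beta$ that is comparable with $\mu$ and satisfies $\alpha(g\alpha')=\beta(h\beta')$ and $g|_{\alpha'}=h|_{\beta'}$.
   Formalization: For finite μ, equivalence of singular decompositions requires the common extension αα′=ββ′ to be a prefix of μ, not merely comparable with μ; with comparability the cardinality claim fails (one vertex, infinitely many loops, G=Z/3, ge=e, g|_e=v). *)

theory Defs
  imports
    "HOL-Analysis.Analysis"
    "HOL-Library.Omega_Words_Fun"
    "Graph_Theory.Digraph"
begin

unbundle cardinal_syntax

text \<open>
  A directed graph \<open>E = (E\<^sup>0, E\<^sup>1, r, s)\<close> is a \<^const>\<open>wf_digraph\<close> with
  \<open>r = head\<close> and \<open>s = tail\<close>.  There is no finiteness or countability assumption; loops and
  parallel edges are allowed.
\<close>

section \<open>Groupoids and self-similar actions\<close>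

record 'g groupoid =
  arrows :: "'g set"
  grange :: "'g \<Rightarrow> 'g"
  gsource :: "'g \<Rightarrow> 'g"
  gcomp :: "'g \<Rightarrow> 'g \<Rightarrow> 'g"

text \<open>The unit space is the subset of those arrows that are the source of some arrow.\<close>

definition gunits :: "('g, 'z) groupoid_scheme \<Rightarrow> 'g set"
  where "gunits G = gsource G ` arrows G"

locale groupoid =
  fixes G :: "('g, 'z) groupoid_scheme"
  assumes source_closed: "g \<in> arrows G \<Longrightarrow> gsource G g \<in> arrows G"
    and range_closed: "g \<in> arrows G \<Longrightarrow> grange G g \<in> arrows G"
    and source_source: "g \<in> arrows G \<Longrightarrow> gsource G (gsource G g) = gsource G g"
    and range_source: "g \<in> arrows G \<Longrightarrow> grange G (gsource G g) = gsource G g"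
    and source_range: "g \<in> arrows G \<Longrightarrow> gsource G (grange G g) = grange G g"
    and range_range: "g \<in> arrows G \<Longrightarrow> grange G (grange G g) = grange G g"
    and comp_closed:
      "\<lbrakk>g \<in> arrows G; h \<in> arrows G; gsource G g = grange G h\<rbrakk> \<Longrightarrow> gcomp G g h \<in> arrows G"
    and range_comp:
      "\<lbrakk>g \<in> arrows G; h \<in> arrows G; gsource G g = grange G h\<rbrakk>
        \<Longrightarrow> grange G (gcomp G g h) = grange G g"
    and source_comp:
      "\<lbrakk>g \<in> arrows G; h \<in> arrows G; gsource G g = grange G h\<rbrakk>
        \<Longrightarrow> gsource G (gcomp G g h) = gsource G h"
    and comp_assoc:
      "\<lbrakk>g \<in> arrows G; h \<in> arrows G; k \<in> arrows G; gsource G g = grange G h;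
        gsource G h = grange G k\<rbrakk> \<Longrightarrow> gcomp G (gcomp G g h) k = gcomp G g (gcomp G h k)"
    and range_unit: "g \<in> arrows G \<Longrightarrow> gcomp G (grange G g) g = g"
    and source_unit: "g \<in> arrows G \<Longrightarrow> gcomp G g (gsource G g) = g"
    and inverse_exists:
      "g \<in> arrows G \<Longrightarrow> \<exists>h\<in>arrows G. grange G h = gsource G g \<and> gsource G h = grange G g \<and>
         gcomp G g h = grange G g \<and> gcomp G h g = gsource G g"

text \<open>
  \<open>eact G g e\<close> is \<open>ge\<close> and \<open>eres G g e\<close> is \<open>g|\<^sub>e\<close>; both are meaningful only if
  \<open>s(g) = r(e)\<close>.  Since \<open>G\<^sup>0 = E\<^sup>0\<close>, the vertices of the graph have the type of the arrows of
  the groupoid.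
\<close>

record ('g, 'e) ss_groupoid = "'g groupoid" +
  eact :: "'g \<Rightarrow> 'e \<Rightarrow> 'e"
  eres :: "'g \<Rightarrow> 'e \<Rightarrow> 'g"

locale self_similar_action = groupoid G + wf_digraph E
  for G :: "('g, 'e) ss_groupoid" and E :: "('g, 'e) pre_digraph" +
  assumes units_eq_verts: "gunits G = verts E"
    and act_closed:
      "\<lbrakk>g \<in> arrows G; e \<in> arcs E; gsource G g = head E e\<rbrakk> \<Longrightarrow> eact G g e \<in> arcs E"
    and range_act:
      "\<lbrakk>g \<in> arrows G; e \<in> arcs E; gsource G g = head E e\<rbrakk>
        \<Longrightarrow> head E (eact G g e) = grange G g"
    and comp_act:
      "\<lbrakk>h \<in> arrows G; g \<in> arrows G; gsource G h = grange G g; e \<in> arcs E; gsource G g = head E e\<rbrakk>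
        \<Longrightarrow> eact G (gcomp G h g) e = eact G h (eact G g e)"
    and unit_act: "e \<in> arcs E \<Longrightarrow> eact G (head E e) e = e"
    and res_closed:
      "\<lbrakk>g \<in> arrows G; e \<in> arcs E; gsource G g = head E e\<rbrakk> \<Longrightarrow> eres G g e \<in> arrows G"
    and comp_res:
      "\<lbrakk>h \<in> arrows G; g \<in> arrows G; gsource G h = grange G g; e \<in> arcs E; gsource G g = head E e\<rbrakk>
        \<Longrightarrow> eres G (gcomp G h g) e = gcomp G (eres G h (eact G g e)) (eres G g e)"
    and source_res:
      "\<lbrakk>g \<in> arrows G; e \<in> arcs E; gsource G g = head E e\<rbrakk>
        \<Longrightarrow> gsource G (eres G g e) = tail E e"
    and range_res:
      "\<lbrakk>g \<in> arrows G; e \<in> arcs E; gsource G g = head E e\<rbrakk>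
        \<Longrightarrow> grange G (eres G g e) = tail E (eact G g e)"

section \<open>Paths\<close>

text \<open>
  A finite path is stored with its range, so that \<open>FPath v []\<close> is the path of length \<open>0\<close> at
  \<open>v\<close>; in \<open>FPath v es\<close> with \<open>es\<close> nonempty the vertex is determined by \<open>es\<close>.
\<close>

datatype ('v, 'e) path = FPath 'v "'e list" | IPath "'e word"

fun prange :: "('v, 'e) pre_digraph \<Rightarrow> ('v, 'e) path \<Rightarrow> 'v"
  where
    "prange E (FPath v es) = v"
  | "prange E (IPath w) = head E (w 0)"

fun psource :: "('v, 'e) pre_digraph \<Rightarrow> ('v, 'e) path \<Rightarrow> 'v"
  where
    "psource E (FPath v es) = (if es = [] then v else tail E (last es))"
  | "psource E (IPath w) = undefined"

definition fin_paths :: "('v, 'e) pre_digraph \<Rightarrow> ('v, 'e) path set"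
  where "fin_paths E = {FPath v es | v es. v \<in> verts E \<and> set es \<subseteq> arcs E \<and>
           (es \<noteq> [] \<longrightarrow> v = head E (hd es)) \<and>
           (\<forall>i. Suc i < length es \<longrightarrow> tail E (es ! i) = head E (es ! Suc i))}"

definition inf_paths :: "('v, 'e) pre_digraph \<Rightarrow> ('v, 'e) path set"
  where "inf_paths E =
           {IPath w | w. \<forall>i. w i \<in> arcs E \<and> tail E (w i) = head E (w (Suc i))}"

text \<open>\<open>E\<^sup>\<le>\<^sup>\<infinity>\<close>\<close>

definition path_space :: "('v, 'e) pre_digraph \<Rightarrow> ('v, 'e) path set"
  where "path_space E = fin_paths E \<union> inf_paths E"

abbreviation vpath :: "'v \<Rightarrow> ('v, 'e) path"
  where "vpath v \<equiv> FPath v []"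

abbreviation epath :: "('v, 'e) pre_digraph \<Rightarrow> 'e \<Rightarrow> ('v, 'e) path"
  where "epath E e \<equiv> FPath (head E e) [e]"

text \<open>
  Concatenation is meaningful only for a finite first argument and a second argument whose range is
  the source of the first; this is what \<open>composable\<close> records.
\<close>

fun pconc :: "('v, 'e) path \<Rightarrow> ('v, 'e) path \<Rightarrow> ('v, 'e) path"  (infixr \<open>\<cdot>\<close> 70)
  where
    "FPath v es \<cdot> FPath u fs = FPath v (es @ fs)"
  | "FPath v es \<cdot> IPath w = IPath (es \<frown> w)"
  | "IPath w \<cdot> \<xi> = undefined"

definition composable :: "('v, 'e) pre_digraph \<Rightarrow> ('v, 'e) path \<Rightarrow> ('v, 'e) path \<Rightarrow> bool"
  where "composable E \<alpha> \<xi> \<longleftrightarrow> \<alpha> \<in> fin_paths E \<and> \<xi> \<in> path_space E \<and> prange E \<xi> = psource E \<alpha>"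

definition is_prefix :: "('v, 'e) pre_digraph \<Rightarrow> ('v, 'e) path \<Rightarrow> ('v, 'e) path \<Rightarrow> bool"
  where "is_prefix E \<alpha> \<mu> \<longleftrightarrow> (\<exists>\<xi>. composable E \<alpha> \<xi> \<and> \<mu> = \<alpha> \<cdot> \<xi>)"

text \<open>\<open>vE\<^sup>1\<close>\<close>

definition edges_at :: "('v, 'e) pre_digraph \<Rightarrow> 'v \<Rightarrow> 'e set"
  where "edges_at E v = {e \<in> arcs E. head E e = v}"

definition singular :: "('v, 'e) pre_digraph \<Rightarrow> 'v \<Rightarrow> bool"
  where "singular E v \<longleftrightarrow> edges_at E v = {} \<or> infinite (edges_at E v)"

definition boundary :: "('v, 'e) pre_digraph \<Rightarrow> ('v, 'e) path set"
  where "boundary E = inf_paths E \<union> {\<mu> \<in> fin_paths E. singular E (psource E \<mu>)}"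

definition cylinder :: "('v, 'e) pre_digraph \<Rightarrow> ('v, 'e) path \<Rightarrow> ('v, 'e) path set"
  where "cylinder E \<alpha> = {\<xi> \<in> path_space E. is_prefix E \<alpha> \<xi>}"

definition path_topology :: "('v, 'e) pre_digraph \<Rightarrow> ('v, 'e) path topology"
  where "path_topology E = topology_generated_by
           {cylinder E \<alpha> - (\<Union>\<beta>\<in>F. cylinder E (\<alpha> \<cdot> \<beta>)) | \<alpha> F.
              \<alpha> \<in> fin_paths E \<and> finite F \<and> F \<subseteq> {\<beta> \<in> fin_paths E. prange E \<beta> = psource E \<alpha>}}"

section \<open>The action on paths\<close>

primrec act_list :: "('g, 'e) ss_groupoid \<Rightarrow> 'g \<Rightarrow> 'e list \<Rightarrow> 'e list"
  where
    "act_list G g [] = []"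
  | "act_list G g (e # es) = eact G g e # act_list G (eres G g e) es"

primrec res_list :: "('g, 'e) ss_groupoid \<Rightarrow> 'g \<Rightarrow> 'e list \<Rightarrow> 'g"
  where
    "res_list G g [] = g"
  | "res_list G g (e # es) = res_list G (eres G g e) es"

fun pact :: "('g, 'e) ss_groupoid \<Rightarrow> 'g \<Rightarrow> ('g, 'e) path \<Rightarrow> ('g, 'e) path"
  where
    "pact G g (FPath v es) = FPath (grange G g) (act_list G g es)"
  | "pact G g (IPath w) = IPath (\<lambda>n. eact G (res_list G g (map w [0..<n])) (w n))"

fun pres :: "('g, 'e) ss_groupoid \<Rightarrow> 'g \<Rightarrow> ('g, 'e) path \<Rightarrow> 'g"
  where
    "pres G g (FPath v es) = res_list G g es"
  | "pres G g (IPath w) = undefined"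

definition fin_strongly_fixed ::
    "('g, 'e) ss_groupoid \<Rightarrow> ('g, 'e) pre_digraph \<Rightarrow> 'g \<Rightarrow> ('g, 'e) path \<Rightarrow> bool"
  where "fin_strongly_fixed G E g \<mu> \<longleftrightarrow>
           \<mu> \<in> fin_paths E \<and> prange E \<mu> = gsource G g \<and> pact G g \<mu> = \<mu> \<and> pres G g \<mu> = psource E \<mu>"

definition strongly_fixed ::
    "('g, 'e) ss_groupoid \<Rightarrow> ('g, 'e) pre_digraph \<Rightarrow> 'g \<Rightarrow> ('g, 'e) path \<Rightarrow> bool"
  where "strongly_fixed G E g \<mu> \<longleftrightarrow> fin_strongly_fixed G E g \<mu> \<or>
           (\<mu> \<in> inf_paths E \<and> (\<exists>\<nu>. is_prefix E \<nu> \<mu> \<and> fin_strongly_fixed G E g \<nu>))"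

section \<open>The groupoids of germs\<close>

definition germ_triples ::
    "('g, 'e) ss_groupoid \<Rightarrow> ('g, 'e) pre_digraph \<Rightarrow> (('g, 'e) path \<times> 'g \<times> ('g, 'e) path) set"
  where "germ_triples G E = {(\<alpha>, g, \<beta>). \<alpha> \<in> fin_paths E \<and> \<beta> \<in> fin_paths E \<and> g \<in> arrows G \<and>
           grange G g = psource E \<alpha> \<and> gsource G g = psource E \<beta>}"

type_synonym ('g, 'e) germ_rep = "('g, 'e) path \<times> 'g \<times> ('g, 'e) path \<times> ('g, 'e) path"

definition germ_reps :: "('g, 'e) ss_groupoid \<Rightarrow> ('g, 'e) pre_digraph \<Rightarrow> ('g, 'e) germ_rep set"
  where "germ_reps G E = {(\<alpha>, g, \<beta>, \<xi>). (\<alpha>, g, \<beta>) \<in> germ_triples G E \<and> \<xi> \<in> cylinder E \<beta>}"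

definition germ_rel ::
    "('g, 'e) ss_groupoid \<Rightarrow> ('g, 'e) pre_digraph \<Rightarrow> ('g, 'e) germ_rep rel"
  where "germ_rel G E = {((\<alpha>, g, \<beta>, \<xi>), (\<gamma>, h, \<delta>, \<eta>)).
           (\<alpha>, g, \<beta>, \<xi>) \<in> germ_reps G E \<and> (\<gamma>, h, \<delta>, \<eta>) \<in> germ_reps G E \<and> \<xi> = \<eta> \<and>
           (\<exists>\<beta>'\<in>fin_paths E. \<exists>\<delta>'\<in>fin_paths E.
              composable E \<beta> \<beta>' \<and> composable E \<delta> \<delta>' \<and>
              \<beta> \<cdot> \<beta>' = \<delta> \<cdot> \<delta>' \<and> is_prefix E (\<beta> \<cdot> \<beta>') \<xi> \<and>
              \<alpha> \<cdot> pact G g \<beta>' = \<gamma> \<cdot> pact G h \<delta>' \<and> pres G g \<beta>' = pres G h \<delta>')}"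

text \<open>\<open>germ G E \<alpha> g \<beta> \<xi>\<close> is the class \<open>[\<alpha>, g, \<beta>; \<xi>]\<close>.\<close>

definition germ ::
    "('g, 'e) ss_groupoid \<Rightarrow> ('g, 'e) pre_digraph \<Rightarrow>
     ('g, 'e) path \<Rightarrow> 'g \<Rightarrow> ('g, 'e) path \<Rightarrow> ('g, 'e) path \<Rightarrow> ('g, 'e) germ_rep set"
  where "germ G E \<alpha> g \<beta> \<xi> = germ_rel G E `` {(\<alpha>, g, \<beta>, \<xi>)}"

definition germs ::
    "('g, 'e) ss_groupoid \<Rightarrow> ('g, 'e) pre_digraph \<Rightarrow> ('g, 'e) germ_rep set set"
  where "germs G E = germ_reps G E // germ_rel G E"

text \<open>
  Source and range of a class are read off from any representative \<open>[\<alpha>, g, \<beta>; \<beta>\<xi>]\<close>.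
\<close>

definition germ_source ::
    "('g, 'e) pre_digraph \<Rightarrow> ('g, 'e) germ_rep set \<Rightarrow> ('g, 'e) path"
  where "germ_source E c = (THE \<eta>. \<exists>\<alpha> g \<beta> \<xi>.
           (\<alpha>, g, \<beta>, \<beta> \<cdot> \<xi>) \<in> c \<and> composable E \<beta> \<xi> \<and> \<eta> = \<beta> \<cdot> \<xi>)"

definition germ_range ::
    "('g, 'e) ss_groupoid \<Rightarrow> ('g, 'e) pre_digraph \<Rightarrow> ('g, 'e) germ_rep set \<Rightarrow> ('g, 'e) path"
  where "germ_range G E c = (THE \<eta>. \<exists>\<alpha> g \<beta> \<xi>.
           (\<alpha>, g, \<beta>, \<beta> \<cdot> \<xi>) \<in> c \<and> composable E \<beta> \<xi> \<and> \<eta> = \<alpha> \<cdot> pact G g \<xi>)"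

text \<open>The inclusion of the unit space: the class \<open>[r(\<xi>), r(\<xi>), r(\<xi>); \<xi>]\<close>.\<close>

definition unit_germ ::
    "('g, 'e) ss_groupoid \<Rightarrow> ('g, 'e) pre_digraph \<Rightarrow> ('g, 'e) path \<Rightarrow> ('g, 'e) germ_rep set"
  where "unit_germ G E \<xi> = germ G E (vpath (prange E \<xi>)) (prange E \<xi>) (vpath (prange E \<xi>)) \<xi>"

definition germ_topology ::
    "('g, 'e) ss_groupoid \<Rightarrow> ('g, 'e) pre_digraph \<Rightarrow> ('g, 'e) germ_rep set topology"
  where "germ_topology G E = topology_generated_by
           {germ G E \<alpha> g \<beta> ` V | \<alpha> g \<beta> V.
              (\<alpha>, g, \<beta>) \<in> germ_triples G E \<and> openin (path_topology E) V \<and> V \<subseteq> cylinder E \<beta>}"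

text \<open>\<open>\<G>(G, E)\<close> is the restriction of the groupoid of all germs to \<open>\<partial>E\<close>.\<close>

definition boundary_germs ::
    "('g, 'e) ss_groupoid \<Rightarrow> ('g, 'e) pre_digraph \<Rightarrow> ('g, 'e) germ_rep set set"
  where "boundary_germs G E =
           {c \<in> germs G E. germ_source E c \<in> boundary E \<and> germ_range G E c \<in> boundary E}"

definition boundary_germ_topology ::
    "('g, 'e) ss_groupoid \<Rightarrow> ('g, 'e) pre_digraph \<Rightarrow> ('g, 'e) germ_rep set topology"
  where "boundary_germ_topology G E = subtopology (germ_topology G E) (boundary_germs G E)"

definition hausdorff_points :: "'a topology \<Rightarrow> 'a set"
  where "hausdorff_points T = {x \<in> topspace T. \<forall>y\<in>topspace T. y \<noteq> x \<longrightarrow>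
           (\<exists>U V. openin T U \<and> openin T V \<and> x \<in> U \<and> y \<in> V \<and> disjnt U V)}"

definition X_bar ::
    "('g, 'e) ss_groupoid \<Rightarrow> ('g, 'e) pre_digraph \<Rightarrow> ('g, 'e) path \<Rightarrow> ('g, 'e) germ_rep set set"
  where "X_bar G E \<mu> = {c \<in> boundary_germs G E. germ_range G E c = \<mu> \<and> germ_source E c = \<mu> \<and>
           c \<in> boundary_germ_topology G E closure_of (unit_germ G E ` boundary E)}"

section \<open>Singular decompositions\<close>

definition inf_sing_decs ::
    "('g, 'e) ss_groupoid \<Rightarrow> ('g, 'e) pre_digraph \<Rightarrow> ('g, 'e) path \<Rightarrow> (('g, 'e) path \<times> 'g) set"
  where "inf_sing_decs G E \<mu> = {(\<alpha>, g). \<alpha> \<in> fin_paths E \<and> g \<in> arrows G \<and> psource E \<alpha> = grange G g \<and>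
           (\<exists>\<xi>. composable E \<alpha> \<xi> \<and> \<mu> = \<alpha> \<cdot> \<xi> \<and> \<not> strongly_fixed G E g \<xi> \<and>
              (\<forall>\<nu>\<in>fin_paths E. is_prefix E \<nu> \<xi> \<longrightarrow>
                 (\<exists>\<eta>. is_prefix E \<nu> \<eta> \<and> strongly_fixed G E g \<eta>)))}"

definition fin_sing_decs ::
    "('g, 'e) ss_groupoid \<Rightarrow> ('g, 'e) pre_digraph \<Rightarrow> ('g, 'e) path \<Rightarrow> (('g, 'e) path \<times> 'g) set"
  where "fin_sing_decs G E \<mu> = {(\<alpha>, g). \<alpha> \<in> fin_paths E \<and> g \<in> arrows G \<and> psource E \<alpha> = grange G g \<and>
           (\<exists>\<xi>. composable E \<alpha> \<xi> \<and> \<mu> = \<alpha> \<cdot> \<xi> \<and> \<not> strongly_fixed G E g \<xi> \<and>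
              (\<exists>I \<subseteq> edges_at E (psource E \<mu>). infinite I \<and>
                 (\<forall>e\<in>I. \<exists>\<eta>. is_prefix E (\<xi> \<cdot> epath E e) \<eta> \<and> strongly_fixed G E g \<eta>)))}"

definition sing_decs ::
    "('g, 'e) ss_groupoid \<Rightarrow> ('g, 'e) pre_digraph \<Rightarrow> ('g, 'e) path \<Rightarrow> (('g, 'e) path \<times> 'g) set"
  where "sing_decs G E \<mu> =
           (if \<mu> \<in> inf_paths E then inf_sing_decs G E \<mu> else fin_sing_decs G E \<mu>)"

definition inf_sing_dec_rel ::
    "('g, 'e) ss_groupoid \<Rightarrow> ('g, 'e) pre_digraph \<Rightarrow> ('g, 'e) path \<Rightarrow> (('g, 'e) path \<times> 'g) rel"
  where "inf_sing_dec_rel G E \<mu> = {((\<alpha>, g), (\<beta>, h)).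
           (\<alpha>, g) \<in> inf_sing_decs G E \<mu> \<and> (\<beta>, h) \<in> inf_sing_decs G E \<mu> \<and>
           (\<exists>\<alpha>'\<in>fin_paths E. \<exists>\<beta>'\<in>fin_paths E.
              composable E \<alpha> \<alpha>' \<and> composable E \<beta> \<beta>' \<and>
              \<alpha> \<cdot> \<alpha>' = \<beta> \<cdot> \<beta>' \<and> is_prefix E (\<alpha> \<cdot> \<alpha>') \<mu> \<and>
              pres G g \<alpha>' = pres G h \<beta>')}"

text \<open>
  The common extension \<open>\<alpha>\<alpha>' = \<beta>\<beta>'\<close> is required to be a prefix of \<open>\<mu>\<close>, as in the definition of
  the classes \<open>[\<alpha>, g, \<beta>; \<xi>]\<close>.  Comparability of \<open>\<alpha>\<alpha>'\<close> with \<open>\<mu>\<close> would not suffice: for one vertex \<open>v\<close>,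
  infinitely many loops and \<open>G = \<int>/3\<close> acting by \<open>ge = e\<close>, \<open>g|\<^sub>e = v\<close>, it would identify the
  singular decompositions \<open>(v, g)\<close>, \<open>(v, g\<^sup>2)\<close> of \<open>\<mu> = v\<close> through the extension \<open>e\<close> of
  \<open>\<mu>\<close>, although \<open>[v, g, v; v] \<noteq> [v, g\<^sup>2, v; v]\<close>; in general it is not even transitive.
\<close>

definition fin_sing_dec_rel ::
    "('g, 'e) ss_groupoid \<Rightarrow> ('g, 'e) pre_digraph \<Rightarrow> ('g, 'e) path \<Rightarrow> (('g, 'e) path \<times> 'g) rel"
  where "fin_sing_dec_rel G E \<mu> = {((\<alpha>, g), (\<beta>, h)).
           (\<alpha>, g) \<in> fin_sing_decs G E \<mu> \<and> (\<beta>, h) \<in> fin_sing_decs G E \<mu> \<and>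
           (\<exists>\<alpha>'\<in>fin_paths E. \<exists>\<beta>'\<in>fin_paths E.
              composable E \<alpha> \<alpha>' \<and> composable E \<beta> \<beta>' \<and>
              \<alpha> \<cdot> \<alpha>' = \<beta> \<cdot> \<beta>' \<and> is_prefix E (\<alpha> \<cdot> \<alpha>') \<mu> \<and>
              \<alpha> \<cdot> pact G g \<alpha>' = \<beta> \<cdot> pact G h \<beta>' \<and> pres G g \<alpha>' = pres G h \<beta>')}"

definition sing_dec_rel ::
    "('g, 'e) ss_groupoid \<Rightarrow> ('g, 'e) pre_digraph \<Rightarrow> ('g, 'e) path \<Rightarrow> (('g, 'e) path \<times> 'g) rel"
  where "sing_dec_rel G E \<mu> =
           (if \<mu> \<in> inf_paths E then inf_sing_dec_rel G E \<mu> else fin_sing_dec_rel G E \<mu>)"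

end

theory Submission
  imports Defs
begin

text \<open>
  If two germs with the same source agree, they agree on a whole cylinder, so the sets
  \<open>{[\<alpha>, g, \<beta>; \<xi>] : \<xi> \<in> V}\<close> form a basis and the topology near a germ is that of the path space near
  its source.  Comparing lengths, \<open>[\<alpha>, g, \<beta>; \<beta>\<zeta>]\<close> is a unit if and only if \<open>\<alpha> = \<beta>\<close> and \<open>\<zeta>\<close> is strongly
  \<open>g\<close>-fixed.  As the path space is Hausdorff, a germ that cannot be separated from the unit \<open>\<mu>\<close> is
  therefore of the form \<open>[\<alpha>, g, \<alpha>; \<mu>]\<close>, and every neighbourhood of \<open>\<mu> = \<alpha>\<zeta>\<close> contains some \<open>\<alpha>\<eta>\<close> with
  \<open>\<eta>\<close> strongly \<open>g\<close>-fixed.  Neighbourhoods of \<open>\<mu>\<close> shrink to the cylinders of its prefixes if \<open>\<mu>\<close> is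
  infinite, and to \<open>Z(\<mu>)\<close> minus finitely many \<open>Z(\<mu>e)\<close> if \<open>\<mu>\<close> is finite; in both cases this turns the
  condition into that of a singular decomposition.  A strongly fixed path stays strongly fixed when
  it is prolonged, hence \<open>\<alpha>\<eta>\<close> can be chosen in \<open>\<partial>E\<close>, and the inseparability already takes place in
  \<open>\<G>(G, E)\<close>.
\<close>

section \<open>Paths\<close>

text \<open>No countability is assumed, so every limit statement is phrased with all open
  \<open>V\<close> instead of sequences. Both topologies are given by generating families, a priori
  only subbases; neighbourhoods are therefore described by induction over the generated open sets.
  Their shapes at finite and infinite paths differ, a difference which \<open>mem_sing_decsE\<close>
  and \<open>mem_sing_decsI\<close> absorb; afterwards only the comparison of the equivalence
  relations distinguishes the two kinds of paths. Equality of germs is decided at a finite prefix: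
  agreement at one prefix passes to all longer ones, and prefixes of one path are comparable.
  Transitivity of the germ relation and well-definedness of the range both come from this. The
  equality of the two non-Hausdorff sets is not formal: restricting to a subspace can only make
  points easier to separate, so the inseparable partner and the approximating units must survive the
  restriction. For the cardinality, singular decompositions map to germs, and the fibres of this map
  are exactly the equivalence classes.\<close>

definition plength :: "('v, 'e) path \<Rightarrow> nat"
  where "plength \<alpha> = (case \<alpha> of FPath v es \<Rightarrow> length es | IPath w \<Rightarrow> 0)"

lemma plength_FPath [simp]: "plength (FPath v es) = length es"
  by (simp add: plength_def)

lemma psource_vpath [simp]: "psource E (vpath v) = v"
  by simp

text \<open>Inductions over edge lists move the base vertex along the first edge. This equation
  serves them better than the defining one with \<open>last\<close>, which leaves the simp set
  below.\<close>

lemma psource_Cons: "psource E (FPath v (e # es)) = psource E (FPath (tail E e) es)"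
  by simp

declare psource.simps(1) [simp del]

lemma psource_append:
  "psource E (FPath v (es @ fs)) = psource E (FPath (psource E (FPath v es)) fs)"
  by (induction es arbitrary: v) (simp_all add: psource_Cons)

context wf_digraph
begin

lemma vpath_mem_fin_paths [simp]: "vpath v \<in> fin_paths G \<longleftrightarrow> v \<in> verts G"
  by (simp add: fin_paths_def)

text \<open>Recursive form of the indexed definition: index 0 is the junction of \<open>e\<close>
  with the rest, the other indices shift by one, and the new base vertex is a vertex because it is
  the source of an edge.\<close>

lemma Cons_mem_fin_paths:
  "FPath v (e # es) \<in> fin_paths G \<longleftrightarrow>
     e \<in> arcs G \<and> head G e = v \<and> FPath (tail G e) es \<in> fin_paths G"
proof -
  have "(\<forall>i. Suc i < length (e # es) \<longrightarrow> tail G ((e # es) ! i) = head G ((e # es) ! Suc i)) \<longleftrightarrow>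
      (es \<noteq> [] \<longrightarrow> tail G e = head G (hd es)) \<and>
      (\<forall>i. Suc i < length es \<longrightarrow> tail G (es ! i) = head G (es ! Suc i))" (is "?l \<longleftrightarrow> ?r")
  proof
    assume l: ?l
    then show ?r
      by (auto simp: hd_conv_nth dest: spec[of _ 0] spec[of _ "Suc _"])
  next
    assume ?r
    then show ?l
      by (auto simp: nth_Cons hd_conv_nth split: nat.splits)
  qed
  then show ?thesis
    using tail_in_verts[of e] unfolding fin_paths_def by (auto simp del: tail_in_verts)
qed

lemma append_mem_fin_paths:
  "FPath v (es @ fs) \<in> fin_paths G \<longleftrightarrow>
     FPath v es \<in> fin_paths G \<and> FPath (psource G (FPath v es)) fs \<in> fin_paths G"
proof (induction es arbitrary: v)
  case Nil
  show ?case
    by (cases fs) (auto simp: Cons_mem_fin_paths)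
qed (auto simp: Cons_mem_fin_paths psource_Cons)

lemma Cons_mem_inf_paths:
  "IPath (e ## w) \<in> inf_paths G \<longleftrightarrow>
     e \<in> arcs G \<and> tail G e = head G (w 0) \<and> IPath w \<in> inf_paths G"
proof -
  define P where "P u i \<longleftrightarrow> u i \<in> arcs G \<and> tail G (u i) = head G (u (Suc i))" for u i
  have "P (e ## w) 0 \<longleftrightarrow> e \<in> arcs G \<and> tail G e = head G (w 0)" "P (e ## w) (Suc i) \<longleftrightarrow> P w i" for i
    by (auto simp: P_def)
  then have "(\<forall>i. P (e ## w) i) \<longleftrightarrow> (e \<in> arcs G \<and> tail G e = head G (w 0)) \<and> (\<forall>i. P w i)"
    by (metis nat.exhaust)
  then show ?thesis
    by (simp add: inf_paths_def P_def)
qed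

text \<open>The left side mentions the range in order to fix \<open>v\<close>, since an infinite
  path does not store its base vertex.\<close>

lemma append_mem_inf_paths:
  "IPath (es \<frown> w) \<in> inf_paths G \<and> prange G (IPath (es \<frown> w)) = v \<longleftrightarrow>
     FPath v es \<in> fin_paths G \<and> IPath w \<in> inf_paths G \<and> head G (w 0) = psource G (FPath v es)"
proof (induction es arbitrary: v)
  case Nil
  show ?case
    by (auto simp: inf_paths_def)
next
  case (Cons e es)
  have "(e # es) \<frown> w = e ## (es \<frown> w)"
    by simp
  then show ?case
    using Cons[of "tail G e"] by (auto simp: Cons_mem_inf_paths Cons_mem_fin_paths psource_Cons)
qed

lemma fin_paths_psource: "\<alpha> \<in> fin_paths G \<Longrightarrow> psource G \<alpha> \<in> verts G"
  using last_in_set by (fastforce simp: fin_paths_def psource.simps)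

lemma path_space_prange: "\<xi> \<in> path_space G \<Longrightarrow> prange G \<xi> \<in> verts G"
  by (auto simp: path_space_def fin_paths_def inf_paths_def)

lemma fin_pathsE:
  assumes "\<alpha> \<in> fin_paths G"
  obtains v es where "\<alpha> = FPath v es"
  using assms by (auto simp: fin_paths_def)

lemma not_fin_and_inf: "\<alpha> \<in> fin_paths G \<Longrightarrow> \<alpha> \<notin> inf_paths G"
  by (auto simp: fin_paths_def inf_paths_def)

section \<open>Concatenation of composable paths\<close>

lemma composableD:
  assumes "composable G \<alpha> \<xi>"
  shows "\<alpha> \<in> fin_paths G" "\<xi> \<in> path_space G" "prange G \<xi> = psource G \<alpha>"
  using assms by (auto simp: composable_def)

text \<open>Concatenation and sources are undefined outside their domain. This normal form of a
  composable pair, as a list followed by a list or by a word, reduces facts about them to lists and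
  words.\<close>

lemma pconc_cases:
  assumes "composable G \<alpha> \<xi>"
  obtains v es fs where "\<alpha> = FPath v es" "\<xi> = FPath (psource G \<alpha>) fs" "FPath v (es @ fs) \<in> fin_paths G"
      "\<xi> \<in> fin_paths G"
  | v es w where "\<alpha> = FPath v es" "\<xi> = IPath w" "IPath (es \<frown> w) \<in> inf_paths G"
      "prange G (IPath (es \<frown> w)) = v" "\<xi> \<in> inf_paths G"
proof -
  obtain v es where \<alpha>: "\<alpha> = FPath v es" "FPath v es \<in> fin_paths G"
    using assms fin_pathsE composableD by metis
  show ?thesis
  proof (cases "\<xi> \<in> fin_paths G")
    case True
    then obtain u fs where "\<xi> = FPath u fs"
      by (rule fin_pathsE)
    then show ?thesis
      using that(1) assms True \<alpha> by (auto simp: composable_def append_mem_fin_paths)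
  next
    case False
    then obtain w where "\<xi> = IPath w" "\<xi> \<in> inf_paths G"
      using composableD(2)[OF assms] by (auto simp: path_space_def inf_paths_def)
    then show ?thesis
      using that(2)[of v es w] append_mem_inf_paths[of es w v] assms \<alpha> by (auto simp: composable_def)
  qed
qed

lemma
  assumes "composable G \<alpha> \<xi>"
  shows pconc_mem_path_space: "\<alpha> \<cdot> \<xi> \<in> path_space G"
    and pconc_mem_fin_paths_iff: "\<alpha> \<cdot> \<xi> \<in> fin_paths G \<longleftrightarrow> \<xi> \<in> fin_paths G"
    and pconc_mem_inf_paths_iff: "\<alpha> \<cdot> \<xi> \<in> inf_paths G \<longleftrightarrow> \<xi> \<in> inf_paths G"
    and prange_pconc: "prange G (\<alpha> \<cdot> \<xi>) = prange G \<alpha>"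
    and psource_pconc: "psource G (\<alpha> \<cdot> \<xi>) = psource G \<xi>"
    and plength_pconc: "\<xi> \<in> fin_paths G \<Longrightarrow> plength (\<alpha> \<cdot> \<xi>) = plength \<alpha> + plength \<xi>"
  using assms
  by (cases rule: pconc_cases; auto simp: path_space_def psource_append dest: not_fin_and_inf)+

lemma pconc_assoc:
  assumes "\<alpha> \<in> fin_paths G" "\<beta> \<in> fin_paths G"
  shows "(\<alpha> \<cdot> \<beta>) \<cdot> \<xi> = \<alpha> \<cdot> \<beta> \<cdot> \<xi>"
  using assms by (cases \<xi>) (auto elim!: fin_pathsE)

lemma pconc_cancel:
  assumes "composable G \<alpha> \<xi>" "composable G \<alpha> \<eta>" "\<alpha> \<cdot> \<xi> = \<alpha> \<cdot> \<eta>"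
  shows "\<xi> = \<eta>"
  using assms(1)
  by (cases rule: pconc_cases; use assms(2) in \<open>cases rule: pconc_cases\<close>; use assms(3) in auto)

lemma composable_pconc:
  assumes "composable G \<alpha> \<beta>" "\<beta> \<in> fin_paths G"
  shows "composable G (\<alpha> \<cdot> \<beta>) \<xi> \<longleftrightarrow> composable G \<beta> \<xi>"
  using assms pconc_mem_fin_paths_iff[OF assms(1)] psource_pconc[OF assms(1)]
  by (auto simp: composable_def)

lemma composable_pconc_right:
  assumes "composable G \<alpha> \<beta>" "composable G \<beta> \<xi>"
  shows "composable G \<alpha> (\<beta> \<cdot> \<xi>)"
  using assms pconc_mem_path_space[OF assms(2)] prange_pconc[OF assms(2)]
  by (auto simp: composable_def)

lemma composable_vpath: "\<xi> \<in> path_space G \<Longrightarrow> composable G (vpath (prange G \<xi>)) \<xi>"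
  by (auto simp: composable_def path_space_prange)

lemma composable_vpath_right: "\<alpha> \<in> fin_paths G \<Longrightarrow> composable G \<alpha> (vpath (psource G \<alpha>))"
  by (auto simp: composable_def path_space_def fin_paths_psource)

lemma vpath_pconc:
  assumes "\<xi> \<in> path_space G"
  shows "vpath (prange G \<xi>) \<cdot> \<xi> = \<xi>"
  by (cases \<xi>) simp_all

lemma pconc_vpath: "\<alpha> \<in> fin_paths G \<Longrightarrow> \<alpha> \<cdot> vpath v = \<alpha>"
  by (auto elim!: fin_pathsE)

section \<open>The prefix order\<close>

lemma is_prefix_pconc: "composable G \<alpha> \<xi> \<Longrightarrow> is_prefix G \<alpha> (\<alpha> \<cdot> \<xi>)"
  by (auto simp: is_prefix_def)

lemma is_prefixE:
  assumes "is_prefix G \<alpha> \<mu>"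
  obtains \<xi> where "composable G \<alpha> \<xi>" "\<mu> = \<alpha> \<cdot> \<xi>"
  using assms by (auto simp: is_prefix_def)

lemma is_prefixD:
  assumes "is_prefix G \<alpha> \<mu>"
  shows "\<alpha> \<in> fin_paths G" "\<mu> \<in> path_space G" "prange G \<mu> = prange G \<alpha>"
  using assms by (auto elim!: is_prefixE simp: composableD pconc_mem_path_space prange_pconc)

lemma is_prefix_refl: "\<alpha> \<in> fin_paths G \<Longrightarrow> is_prefix G \<alpha> \<alpha>"
  using is_prefix_pconc[OF composable_vpath_right] by (simp add: pconc_vpath)

lemma is_prefix_vpath: "\<xi> \<in> path_space G \<Longrightarrow> is_prefix G (vpath (prange G \<xi>)) \<xi>"
  using is_prefix_pconc[OF composable_vpath] by (simp add: vpath_pconc)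

lemma is_prefix_pconc_mono:
  assumes "composable G \<alpha> \<beta>" "is_prefix G \<beta> \<xi>"
  shows "is_prefix G (\<alpha> \<cdot> \<beta>) (\<alpha> \<cdot> \<xi>)"
proof -
  obtain \<eta> where \<eta>: "composable G \<beta> \<eta>" "\<xi> = \<beta> \<cdot> \<eta>"
    using assms(2) by (rule is_prefixE)
  have \<beta>: "\<beta> \<in> fin_paths G"
    using assms(2) by (rule is_prefixD)
  have "composable G (\<alpha> \<cdot> \<beta>) \<eta>"
    using composable_pconc[OF assms(1) \<beta>] \<eta>(1) by simp
  moreover have "\<alpha> \<cdot> \<xi> = (\<alpha> \<cdot> \<beta>) \<cdot> \<eta>"
    using pconc_assoc[of \<alpha> \<beta>] \<beta> composableD(1)[OF assms(1)] \<eta>(2) by simp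
  ultimately show ?thesis
    by (auto simp: is_prefix_def)
qed

lemma is_prefix_trans:
  assumes "is_prefix G \<alpha> \<beta>" "is_prefix G \<beta> \<xi>"
  shows "is_prefix G \<alpha> \<xi>"
proof -
  obtain \<alpha>' where \<alpha>': "composable G \<alpha> \<alpha>'" "\<beta> = \<alpha> \<cdot> \<alpha>'"
    using assms(1) by (rule is_prefixE)
  obtain \<eta> where \<eta>: "composable G \<beta> \<eta>" "\<xi> = \<beta> \<cdot> \<eta>"
    using assms(2) by (rule is_prefixE)
  have fin: "\<alpha>' \<in> fin_paths G"
    using pconc_mem_fin_paths_iff[OF \<alpha>'(1)] composableD(1)[OF \<eta>(1)] \<alpha>'(2) by simp
  have "composable G \<alpha>' \<eta>"
    using composable_pconc[OF \<alpha>'(1) fin] \<eta>(1) \<alpha>'(2) by simp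
  then have "composable G \<alpha> (\<alpha>' \<cdot> \<eta>)"
    by (rule composable_pconc_right[OF \<alpha>'(1)])
  moreover have "\<xi> = \<alpha> \<cdot> \<alpha>' \<cdot> \<eta>"
    using pconc_assoc[OF composableD(1)[OF \<alpha>'(1)] fin] \<alpha>'(2) \<eta>(2) by simp
  ultimately show ?thesis
    by (auto simp: is_prefix_def)
qed

text \<open>Both prefixes agree with \<xi> letter by letter, so the shorter is an initial segment of
  the longer. Hence the prefixes of a given path form a chain, ordered by length.\<close>

lemma is_prefix_plength_le:
  assumes "is_prefix G \<alpha> \<xi>" "is_prefix G \<beta> \<xi>" "plength \<alpha> \<le> plength \<beta>"
  shows "is_prefix G \<alpha> \<beta>"
proof -
  obtain \<alpha>' where \<alpha>': "composable G \<alpha> \<alpha>'" "\<xi> = \<alpha> \<cdot> \<alpha>'"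
    using assms(1) by (rule is_prefixE)
  obtain \<beta>' where \<beta>': "composable G \<beta> \<beta>'" "\<xi> = \<beta> \<cdot> \<beta>'"
    using assms(2) by (rule is_prefixE)
  obtain v es u fs where eqs: "\<alpha> = FPath v es" "\<beta> = FPath u fs"
    using composableD(1)[OF \<alpha>'(1)] composableD(1)[OF \<beta>'(1)] fin_pathsE by metis
  have "v = u"
    using is_prefixD(3)[OF assms(1)] is_prefixD(3)[OF assms(2)] eqs by simp
  have len: "length es \<le> length fs"
    using assms(3) eqs by simp
  have "\<exists>gs. fs = es @ gs"
  proof (cases "\<xi> \<in> fin_paths G")
    case True
    then show ?thesis
      using \<alpha>' \<beta>' eqs len
      using not_fin_and_inf[OF True]
      by (cases \<alpha>'; cases \<beta>'; auto simp: append_eq_append_conv2 fin_paths_def)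
  next
    case False
    then have "\<alpha>' \<notin> fin_paths G" "\<beta>' \<notin> fin_paths G"
      using \<alpha>' \<beta>' pconc_mem_fin_paths_iff by metis+
    then obtain w w' where "\<alpha>' = IPath w" "\<beta>' = IPath w'"
      using composableD(2)[OF \<alpha>'(1)] composableD(2)[OF \<beta>'(1)]
      by (auto simp: path_space_def inf_paths_def)
    then have "es \<frown> w = fs \<frown> w'"
      using \<alpha>' \<beta>' eqs by simp
    then have "es ! i = fs ! i" if "i < length es" for i
      using that len by (metis conc_fst order_less_le_trans)
    then have "es = take (length es) fs"
      using len by (simp add: list_eq_iff_nth_eq)
    then show ?thesis
      by (metis append_take_drop_id)
  qed
  then obtain gs where gs: "fs = es @ gs"
    by blast
  have "FPath (psource G \<alpha>) gs \<in> fin_paths G"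
    using composableD(1)[OF \<beta>'(1)] eqs gs \<open>v = u\<close> by (simp add: append_mem_fin_paths)
  then have "composable G \<alpha> (FPath (psource G \<alpha>) gs)"
    using composableD(1)[OF \<alpha>'(1)] by (simp add: composable_def path_space_def)
  then show ?thesis
    using eqs gs \<open>v = u\<close> by (auto simp: is_prefix_def)
qed

lemma is_prefix_comparable:
  assumes "is_prefix G \<alpha> \<xi>" "is_prefix G \<beta> \<xi>"
  shows "is_prefix G \<alpha> \<beta> \<or> is_prefix G \<beta> \<alpha>"
  using is_prefix_plength_le[OF assms] is_prefix_plength_le[OF assms(2,1)] by linarith

lemma is_prefix_fin_pathsE:
  assumes "is_prefix G \<alpha> \<beta>" "\<beta> \<in> fin_paths G"
  obtains \<alpha>' where "composable G \<alpha> \<alpha>'" "\<beta> = \<alpha> \<cdot> \<alpha>'" "\<alpha>' \<in> fin_paths G"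
  using assms by (metis is_prefixE pconc_mem_fin_paths_iff)

lemma is_prefix_length:
  assumes "is_prefix G \<alpha> \<beta>" "\<beta> \<in> fin_paths G"
  shows "plength \<alpha> \<le> plength \<beta>"
  using assms by (elim is_prefix_fin_pathsE) (auto simp: plength_pconc)

text \<open>Comparing lengths, the factor completing \<alpha> to \<beta> has length 0, so it is a
  vertex.\<close>

lemma is_prefix_antisym:
  assumes "is_prefix G \<alpha> \<beta>" "is_prefix G \<beta> \<alpha>"
  shows "\<alpha> = \<beta>"
proof -
  have \<beta>: "\<beta> \<in> fin_paths G"
    using assms(2) by (rule is_prefixD)
  obtain \<alpha>' where \<alpha>': "composable G \<alpha> \<alpha>'" "\<beta> = \<alpha> \<cdot> \<alpha>'" "\<alpha>' \<in> fin_paths G"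
    using is_prefix_fin_pathsE[OF assms(1) \<beta>] by metis
  have "plength \<alpha>' = 0"
    using is_prefix_length[OF assms(2) is_prefixD(1)[OF assms(1)]] \<alpha>' plength_pconc by fastforce
  then show ?thesis
    using \<alpha>' by (auto elim!: fin_pathsE simp: pconc_vpath is_prefixD[OF assms(1)])
qed

lemma is_prefix_pconc_cancel:
  assumes "composable G \<alpha> \<beta>" "\<beta> \<in> fin_paths G" "composable G \<alpha> \<xi>" "is_prefix G (\<alpha> \<cdot> \<beta>) (\<alpha> \<cdot> \<xi>)"
  shows "is_prefix G \<beta> \<xi>"
proof -
  obtain \<rho> where \<rho>: "composable G (\<alpha> \<cdot> \<beta>) \<rho>" "\<alpha> \<cdot> \<xi> = (\<alpha> \<cdot> \<beta>) \<cdot> \<rho>"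
    using assms(4) by (rule is_prefixE)
  have comp: "composable G \<beta> \<rho>"
    using composable_pconc assms(1,2) \<rho>(1) by metis
  have "\<alpha> \<cdot> \<xi> = \<alpha> \<cdot> \<beta> \<cdot> \<rho>"
    using \<rho>(2) pconc_assoc[OF composableD(1)[OF assms(1)] assms(2)] by simp
  then have "\<xi> = \<beta> \<cdot> \<rho>"
    using pconc_cancel assms(3) composable_pconc_right[OF assms(1) comp] by metis
  then show ?thesis
    using is_prefix_pconc[OF comp] by simp
qed

lemma composable_prefix:
  assumes "composable G \<alpha> \<xi>" "is_prefix G \<nu> \<xi>"
  shows "composable G \<alpha> \<nu>"
  using composableD[OF assms(1)] is_prefixD[OF assms(2)] by (simp add: composable_def path_space_def)

lemma composable_extension:
  assumes "composable G \<alpha> \<nu>" "is_prefix G \<nu> \<xi>"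
  shows "composable G \<alpha> \<xi>"
  using composableD[OF assms(1)] is_prefixD[OF assms(2)] by (simp add: composable_def path_space_def)

section \<open>First edges, prefixes of infinite paths, extensions to the boundary\<close>

text \<open>Every proper extension of a finite path \<mu> thus lies in some Z(\<mu>e). The edge is
  the head of a nonempty list or the letter 0 of a word.\<close>

lemma epath_split:
  assumes "composable G \<mu> \<rho>" "\<rho> \<noteq> vpath (psource G \<mu>)"
  obtains e where "e \<in> edges_at G (psource G \<mu>)" "is_prefix G (epath G e) \<rho>"
  using assms(1)
proof (cases rule: pconc_cases)
  case (1 v es fs)
  then obtain e fs' where fs: "fs = e # fs'"
    using assms(2) by (cases fs) auto
  have "FPath (psource G \<mu>) (e # fs') \<in> fin_paths G"
    using 1 fs by simp
  then have *: "head G e = psource G \<mu>" "e \<in> arcs G" "FPath (tail G e) fs' \<in> fin_paths G"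
    unfolding Cons_mem_fin_paths by auto
  have "composable G (epath G e) (FPath (tail G e) fs')"
    unfolding composable_def path_space_def psource_Cons Cons_mem_fin_paths using * by auto
  then have "is_prefix G (epath G e) \<rho>"
    using 1 fs *(1) is_prefix_pconc by force
  then show ?thesis
    using that *(1,2) by (simp add: edges_at_def)
next
  case (2 v es w)
  let ?e = "w 0" and ?w = "suffix 1 w"
  have w: "w = ?e ## ?w"
    by (rule build_split)
  have "IPath (?e ## ?w) \<in> inf_paths G"
    using 2 w by metis
  then have *: "?e \<in> arcs G" "tail G ?e = head G (?w 0)" "IPath ?w \<in> inf_paths G"
    unfolding Cons_mem_inf_paths by auto
  have "head G ?e = psource G \<mu>"
    using composableD(3)[OF assms(1)] 2 by simp
  have "epath G ?e \<in> fin_paths G"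
    using *(1) by (simp add: Cons_mem_fin_paths)
  then have "composable G (epath G ?e) (IPath ?w)"
    using *(2,3) by (simp add: composable_def path_space_def psource_Cons)
  then have "is_prefix G (epath G ?e) \<rho>"
    using 2(2) w is_prefix_pconc by force
  then show ?thesis
    using that[of ?e] *(1) \<open>head G ?e = psource G \<mu>\<close> by (simp add: edges_at_def)
qed

lemma composable_epath:
  assumes "\<mu> \<in> fin_paths G" "e \<in> edges_at G (psource G \<mu>)"
  shows "composable G \<mu> (epath G e)" "epath G e \<in> fin_paths G"
  using assms by (auto simp: composable_def path_space_def edges_at_def Cons_mem_fin_paths)

lemma inf_paths_prefix_plength:
  assumes "\<mu> \<in> inf_paths G"
  obtains \<nu> where "is_prefix G \<nu> \<mu>" "plength \<nu> = n"
proof -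
  obtain w where w: "\<mu> = IPath w"
    using assms by (auto simp: inf_paths_def)
  define es where "es = map w [0..<n]"
  have "w = es \<frown> suffix n w"
    by (rule ext) (auto simp: es_def conc_def suffix_def)
  then have *: "FPath (head G (w 0)) es \<in> fin_paths G" "IPath (suffix n w) \<in> inf_paths G"
      "head G (suffix n w 0) = psource G (FPath (head G (w 0)) es)"
    using append_mem_inf_paths[of es "suffix n w" "head G (w 0)"] assms w
    by auto
  then have "composable G (FPath (head G (w 0)) es) (IPath (suffix n w))"
    by (auto simp: composable_def path_space_def)
  then have "is_prefix G (FPath (head G (w 0)) es) \<mu>"
    using w \<open>w = es \<frown> suffix n w\<close> by (auto simp: is_prefix_def)
  then show ?thesis
    using that[of "FPath (head G (w 0)) es"] by (simp add: es_def)
qed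

text \<open>This is why cylinders separate points. Two finite paths are prefixes of each other; an
  infinite path has prefixes longer than any given finite path; and the letter \<open>n\<close> of a
  word is visible in its prefix of length \<open>Suc n\<close>.\<close>

lemma path_eqI:
  assumes "\<xi> \<in> path_space G" "\<eta> \<in> path_space G"
    and "\<And>\<nu>. is_prefix G \<nu> \<xi> \<longleftrightarrow> is_prefix G \<nu> \<eta>"
  shows "\<xi> = \<eta>"
proof (cases "\<xi> \<in> fin_paths G \<or> \<eta> \<in> fin_paths G")
  case True
  moreover have "\<xi> = \<eta>" if "\<xi> \<in> fin_paths G" "\<eta> \<in> fin_paths G"
    using that assms(3) is_prefix_antisym is_prefix_refl by metis
  moreover have False if \<xi>: "\<xi> \<in> fin_paths G" and \<eta>: "\<eta> \<in> inf_paths G"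
      and iff: "\<And>\<nu>. is_prefix G \<nu> \<xi> \<longleftrightarrow> is_prefix G \<nu> \<eta>" for \<xi> \<eta>
  proof -
    obtain \<nu> where "is_prefix G \<nu> \<eta>" "plength \<nu> = Suc (plength \<xi>)"
      using inf_paths_prefix_plength[OF \<eta>] by metis
    then show False
      using iff[of \<nu>] is_prefix_length[OF _ \<xi>, of \<nu>] by auto
  qed
  ultimately show ?thesis
    using assms by (metis UnE path_space_def)
next
  case False
  then have "\<xi> \<in> inf_paths G" "\<eta> \<in> inf_paths G"
    using assms by (auto simp: path_space_def)
  then obtain w u where eqs: "\<xi> = IPath w" "\<eta> = IPath u"
    by (auto simp: inf_paths_def)
  have "w n = u n" for n
  proof -
    obtain \<nu> where \<nu>: "is_prefix G \<nu> \<xi>" "plength \<nu> = Suc n"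
      using inf_paths_prefix_plength[OF \<open>\<xi> \<in> inf_paths G\<close>] by metis
    obtain v es where "\<nu> = FPath v es"
      using fin_pathsE is_prefixD(1)[OF \<nu>(1)] by metis
    moreover obtain w' u' where "composable G \<nu> w'" "\<xi> = \<nu> \<cdot> w'" "composable G \<nu> u'" "\<eta> = \<nu> \<cdot> u'"
      using \<nu>(1) assms(3)[of \<nu>] by (metis is_prefixE)
    ultimately show ?thesis
      using eqs \<nu>(2) by (cases w'; cases u') auto
  qed
  then show ?thesis
    using eqs by auto
qed

lemma boundary_subset_path_space: "boundary G \<subseteq> path_space G"
  by (auto simp: boundary_def path_space_def)

text \<open>Either some finite extension of \<kappa> ends at a vertex that receives no edge, which
  is singular, or an edge can always be appended and an infinite extension arises. So every cylinder
  meets the boundary.\<close>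

lemma boundary_extension:
  assumes "\<kappa> \<in> fin_paths G"
  obtains \<xi> where "\<xi> \<in> boundary G" "is_prefix G \<kappa> \<xi>"
proof (cases "\<exists>\<kappa>'\<in>fin_paths G. is_prefix G \<kappa> \<kappa>' \<and> edges_at G (psource G \<kappa>') = {}")
  case True
  then show ?thesis
    using that by (auto simp: boundary_def singular_def)
next
  case False
  \<comment> \<open>The invariant of the choice remembers only that \<open>e\<close> can be appended
    to some finite extension of \<kappa>, which is enough to rule out a dead end after
    \<open>e\<close>. Consecutive edges fit by the other part of the choice, and the clause for
    \<open>n = 0\<close> attaches the first edge to \<kappa>.\<close>
  define P where "P e \<longleftrightarrow>
    (\<exists>\<kappa>'. is_prefix G \<kappa> \<kappa>' \<and> \<kappa>' \<in> fin_paths G \<and> e \<in> edges_at G (psource G \<kappa>'))" for e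
  have "\<exists>w. \<forall>n. (P (w n) \<and> (n = 0 \<longrightarrow> head G (w n) = psource G \<kappa>)) \<and> tail G (w n) = head G (w (Suc n))"
  proof (rule dependent_nat_choice)
    show "\<exists>e. P e \<and> (0 = (0::nat) \<longrightarrow> head G e = psource G \<kappa>)"
      using False assms is_prefix_refl unfolding P_def edges_at_def by blast
  next
    fix e and n :: nat
    assume "P e \<and> (n = 0 \<longrightarrow> head G e = psource G \<kappa>)"
    then obtain \<kappa>' where \<kappa>': "is_prefix G \<kappa> \<kappa>'" "\<kappa>' \<in> fin_paths G" "e \<in> edges_at G (psource G \<kappa>')"
      unfolding P_def by blast
    note ce = composable_epath[OF \<kappa>'(2,3)]
    have ext: "is_prefix G \<kappa> (\<kappa>' \<cdot> epath G e)" "\<kappa>' \<cdot> epath G e \<in> fin_paths G"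
      using is_prefix_trans[OF \<kappa>'(1) is_prefix_pconc[OF ce(1)]] pconc_mem_fin_paths_iff[OF ce(1)] ce(2)
      by auto
    moreover have "psource G (\<kappa>' \<cdot> epath G e) = tail G e"
      using psource_pconc[OF ce(1)] by (simp add: psource_Cons)
    ultimately show "\<exists>f. (P f \<and> (Suc n = 0 \<longrightarrow> head G f = psource G \<kappa>)) \<and> tail G e = head G f"
      using False unfolding P_def edges_at_def by force
  qed
  then obtain w where w: "\<And>n. P (w n)" "head G (w 0) = psource G \<kappa>"
      "\<And>n. tail G (w n) = head G (w (Suc n))"
    by blast
  then have "IPath w \<in> inf_paths G"
    by (auto simp: inf_paths_def P_def edges_at_def)
  then have "composable G \<kappa> (IPath w)"
    using assms w(2) by (auto simp: composable_def path_space_def)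
  then show ?thesis
    using that[of "\<kappa> \<cdot> IPath w"] pconc_mem_inf_paths_iff is_prefix_pconc \<open>IPath w \<in> inf_paths G\<close>
    by (auto simp: boundary_def)
qed

section \<open>The topology on paths\<close>

lemma mem_cylinder: "\<xi> \<in> cylinder G \<alpha> \<longleftrightarrow> is_prefix G \<alpha> \<xi>"
  using is_prefixD(2) by (auto simp: cylinder_def)

lemma openin_cylinder_diff:
  assumes "\<alpha> \<in> fin_paths G" "finite F" "\<And>\<beta>. \<beta> \<in> F \<Longrightarrow> composable G \<alpha> \<beta> \<and> \<beta> \<in> fin_paths G"
  shows "openin (path_topology G) (cylinder G \<alpha> - (\<Union>\<beta>\<in>F. cylinder G (\<alpha> \<cdot> \<beta>)))"
  unfolding path_topology_def
  by (rule topology_generated_by_Basis) (use assms in \<open>auto simp: composable_def\<close>)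

lemma openin_cylinder: "\<alpha> \<in> fin_paths G \<Longrightarrow> openin (path_topology G) (cylinder G \<alpha>)"
  using openin_cylinder_diff[of \<alpha> "{}"] by simp

lemma topspace_path_topology: "topspace (path_topology G) = path_space G"
proof
  show "topspace (path_topology G) \<subseteq> path_space G"
    by (auto simp: path_topology_def topology_generated_by_topspace cylinder_def)
  show "path_space G \<subseteq> topspace (path_topology G)"
  proof
    fix \<xi> assume \<xi>: "\<xi> \<in> path_space G"
    then have "\<xi> \<in> cylinder G (vpath (prange G \<xi>))"
      by (simp add: mem_cylinder is_prefix_vpath)
    moreover have "openin (path_topology G) (cylinder G (vpath (prange G \<xi>)))"
      using openin_cylinder path_space_prange[OF \<xi>] by simp
    ultimately show "\<xi> \<in> topspace (path_topology G)"
      using openin_subset by blast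
  qed
qed

lemma openin_path_topology_subset: "openin (path_topology G) V \<Longrightarrow> V \<subseteq> path_space G"
  using openin_subset topspace_path_topology by metis

text \<open>The generating sets offer complements only inside a cylinder, so the complement is
  covered by the cylinders Z(v) of vertices: Z(v) - Z(\<beta>) is a generating set if v is the range
  of \<beta>, and otherwise Z(v) misses Z(\<beta>).\<close>

lemma openin_path_space_diff_cylinder:
  assumes "\<beta> \<in> fin_paths G"
  shows "openin (path_topology G) (path_space G - cylinder G \<beta>)"
proof (subst openin_subopen, intro ballI)
  fix \<xi> assume \<xi>: "\<xi> \<in> path_space G - cylinder G \<beta>"
  let ?v = "prange G \<xi>"
  have v: "vpath ?v \<in> fin_paths G"
    using \<xi> path_space_prange by simp
  have sub: "cylinder G (vpath ?v) \<subseteq> path_space G"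
    by (simp add: cylinder_def)
  have mem: "\<xi> \<in> cylinder G (vpath ?v)"
    using \<xi> by (simp add: mem_cylinder is_prefix_vpath)
  show "\<exists>T. openin (path_topology G) T \<and> \<xi> \<in> T \<and> T \<subseteq> path_space G - cylinder G \<beta>"
  proof (cases "prange G \<beta> = ?v")
    case True
    then have "composable G (vpath ?v) \<beta>" "vpath ?v \<cdot> \<beta> = \<beta>"
      using assms composable_vpath[of \<beta>] vpath_pconc[of \<beta>] by (auto simp: path_space_def)
    then have "openin (path_topology G) (cylinder G (vpath ?v) - cylinder G \<beta>)"
      using openin_cylinder_diff[OF v, of "{\<beta>}"] assms by simp
    then show ?thesis
      using mem sub \<xi> by blast
  next
    case False
    then have "cylinder G (vpath ?v) \<inter> cylinder G \<beta> = {}"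
      by (metis (no_types) disjoint_iff is_prefixD(3) mem_cylinder prange.simps(1))
    then show ?thesis
      using openin_cylinder[OF v] mem sub by blast
  qed
qed

lemma openin_cylinder_diff_edges:
  assumes "\<mu> \<in> fin_paths G" "finite F" "F \<subseteq> edges_at G (psource G \<mu>)"
  shows "openin (path_topology G) (cylinder G \<mu> - (\<Union>e\<in>F. cylinder G (\<mu> \<cdot> epath G e)))"
  using openin_cylinder_diff[OF assms(1), of "epath G ` F"] assms composable_epath[OF assms(1)]
  by fastforce

text \<open>A prefix of only one of the two paths has a clopen cylinder that contains one and not
  the other.\<close>

lemma path_topology_separation:
  assumes "\<xi> \<in> path_space G" "\<eta> \<in> path_space G" "\<xi> \<noteq> \<eta>"
  obtains U V where "openin (path_topology G) U" "openin (path_topology G) V" "\<xi> \<in> U" "\<eta> \<in> V"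
    "U \<inter> V = {}"
proof -
  obtain \<nu> where "is_prefix G \<nu> \<xi> \<noteq> is_prefix G \<nu> \<eta>"
    using path_eqI assms by metis
  moreover from this have "\<nu> \<in> fin_paths G"
    using is_prefixD by blast
  ultimately show ?thesis
    using that[of "cylinder G \<nu>" "path_space G - cylinder G \<nu>"]
      that[of "path_space G - cylinder G \<nu>" "cylinder G \<nu>"]
      openin_cylinder openin_path_space_diff_cylinder assms
    by (auto simp: mem_cylinder)
qed

section \<open>Neighbourhoods of infinite and of finite paths\<close>

text \<open>A length bound rather than a single prefix makes the induction work: for an intersection
  one takes the maximum of the two bounds.\<close>

lemma inf_path_nbhd:
  assumes "openin (path_topology G) V" "\<mu> \<in> V" "\<mu> \<in> inf_paths G"
  obtains N where "\<And>\<nu>. is_prefix G \<nu> \<mu> \<Longrightarrow> N \<le> plength \<nu> \<Longrightarrow> cylinder G \<nu> \<subseteq> V"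
proof -
  have "\<exists>N. \<forall>\<nu>. is_prefix G \<nu> \<mu> \<longrightarrow> N \<le> plength \<nu> \<longrightarrow> cylinder G \<nu> \<subseteq> V"
    using assms(1,2) unfolding path_topology_def openin_topology_generated_by_iff
  proof (induction rule: generate_topology_on.induct)
    case (Int a b)
    then obtain N M where "\<forall>\<nu>. is_prefix G \<nu> \<mu> \<longrightarrow> N \<le> plength \<nu> \<longrightarrow> cylinder G \<nu> \<subseteq> a"
        "\<forall>\<nu>. is_prefix G \<nu> \<mu> \<longrightarrow> M \<le> plength \<nu> \<longrightarrow> cylinder G \<nu> \<subseteq> b"
      by auto
    then show ?case
      by (intro exI[of _ "max N M"]) auto
  next
    case (UN K)
    then obtain k where "k \<in> K" "\<mu> \<in> k"
      by blast
    then obtain N where "\<forall>\<nu>. is_prefix G \<nu> \<mu> \<longrightarrow> N \<le> plength \<nu> \<longrightarrow> cylinder G \<nu> \<subseteq> k"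
      using UN.IH by blast
    then show ?case
      using \<open>k \<in> K\<close> by (intro exI[of _ N]) blast
  next
    case (Basis s)
    then obtain \<alpha> F where s: "s = cylinder G \<alpha> - (\<Union>\<beta>\<in>F. cylinder G (\<alpha> \<cdot> \<beta>))" "finite F"
      by auto
    \<comment> \<open>The sum exceeds the length of \<alpha> and of each excluded \<alpha>\<beta>.
      If \<nu> is at least that long, an \<alpha>\<beta> that is a prefix of some \<eta> in Z(\<nu>)
      is already a prefix of \<nu>, hence of \<mu>, which is excluded.\<close>
    define N where "N = plength \<alpha> + (\<Sum>\<beta>\<in>F. plength (\<alpha> \<cdot> \<beta>))"
    have N: "plength (\<alpha> \<cdot> \<beta>) \<le> N" if "\<beta> \<in> F" for \<beta>
      using member_le_sum[OF that, of "\<lambda>\<beta>. plength (\<alpha> \<cdot> \<beta>)"] s(2) by (simp add: N_def)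
    show ?case
    proof (intro exI[of _ N] allI impI subsetI)
      fix \<nu> \<eta>
      assume \<nu>: "is_prefix G \<nu> \<mu>" "N \<le> plength \<nu>" and "\<eta> \<in> cylinder G \<nu>"
      then have \<eta>: "is_prefix G \<nu> \<eta>"
        by (simp add: mem_cylinder)
      have "is_prefix G \<alpha> \<nu>"
        using is_prefix_plength_le[OF _ \<nu>(1), of \<alpha>] \<nu>(2) Basis(2) s(1)
        by (simp add: mem_cylinder N_def)
      then have "is_prefix G \<alpha> \<eta>"
        using \<eta> by (rule is_prefix_trans)
      moreover have "\<not> is_prefix G (\<alpha> \<cdot> \<beta>) \<eta>" if "\<beta> \<in> F" for \<beta>
      proof
        assume "is_prefix G (\<alpha> \<cdot> \<beta>) \<eta>"
        then have "is_prefix G (\<alpha> \<cdot> \<beta>) \<nu>"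
          using is_prefix_plength_le[OF _ \<eta>] N[OF that] \<nu>(2) by simp
        then have "is_prefix G (\<alpha> \<cdot> \<beta>) \<mu>"
          using \<nu>(1) by (rule is_prefix_trans)
        then show False
          using Basis(2) s(1) that by (auto simp: mem_cylinder)
      qed
      ultimately show "\<eta> \<in> s"
        by (auto simp: s(1) mem_cylinder)
    qed
  qed simp
  then show ?thesis
    using that by blast
qed

text \<open>In a generating set around \<mu>, each excluded \<alpha>\<beta> is either incomparable
  with \<mu> or a proper extension of it. In the second case it continues \<mu> with some edge e,
  and removing Z(\<mu>e) removes Z(\<alpha>\<beta>) too; one edge for each \<beta> is
  enough.\<close>

lemma fin_path_nbhd:
  assumes "openin (path_topology G) V" "\<mu> \<in> V" "\<mu> \<in> fin_paths G"
  obtains F where "finite F" "F \<subseteq> edges_at G (psource G \<mu>)"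
    "cylinder G \<mu> - (\<Union>e\<in>F. cylinder G (\<mu> \<cdot> epath G e)) \<subseteq> V"
proof -
  define N where "N F = cylinder G \<mu> - (\<Union>e\<in>F. cylinder G (\<mu> \<cdot> epath G e))" for F
  have "\<exists>F. finite F \<and> F \<subseteq> edges_at G (psource G \<mu>) \<and> N F \<subseteq> V"
    using assms(1,2) unfolding path_topology_def openin_topology_generated_by_iff
  proof (induction rule: generate_topology_on.induct)
    case (Int a b)
    then obtain F F' where "finite F" "F \<subseteq> edges_at G (psource G \<mu>)" "N F \<subseteq> a"
        "finite F'" "F' \<subseteq> edges_at G (psource G \<mu>)" "N F' \<subseteq> b"
      by auto
    moreover have "N (F \<union> F') \<subseteq> N F \<inter> N F'"
      by (auto simp: N_def)
    ultimately show ?case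
      by (intro exI[of _ "F \<union> F'"]) blast
  next
    case (UN K)
    then obtain k where k: "k \<in> K" "\<mu> \<in> k"
      by blast
    then obtain F where "finite F" "F \<subseteq> edges_at G (psource G \<mu>)" "N F \<subseteq> k"
      using UN.IH by blast
    then show ?case
      using k(1) by blast
  next
    case (Basis s)
    then obtain \<alpha> F where s: "s = cylinder G \<alpha> - (\<Union>\<beta>\<in>F. cylinder G (\<alpha> \<cdot> \<beta>))" "finite F"
      by auto
    \<comment> \<open>\<open>P \<beta> e\<close> says that e is the edge following \<mu> in
      \<alpha>\<beta>. Choosing it for each \<beta> that has one makes the set of removed edges a
      finite image.\<close>
    define P where "P \<beta> e \<longleftrightarrow> e \<in> edges_at G (psource G \<mu>) \<and> is_prefix G (\<mu> \<cdot> epath G e) (\<alpha> \<cdot> \<beta>)"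
      for \<beta> e
    define F' where "F' = (\<lambda>\<beta>. SOME e. P \<beta> e) ` {\<beta> \<in> F. \<exists>e. P \<beta> e}"
    have P: "P \<beta> (SOME e. P \<beta> e)" if "\<exists>e. P \<beta> e" for \<beta>
      using that by (rule someI_ex)
    have "finite F'" "F' \<subseteq> edges_at G (psource G \<mu>)"
      using s(2) P by (auto simp: F'_def P_def)
    moreover have "N F' \<subseteq> s"
    proof
      fix \<eta> assume \<eta>: "\<eta> \<in> N F'"
      then have \<mu>\<eta>: "is_prefix G \<mu> \<eta>"
        by (simp add: N_def mem_cylinder)
      have "is_prefix G \<alpha> \<mu>"
        using Basis(2) s(1) by (simp add: mem_cylinder)
      then have "is_prefix G \<alpha> \<eta>"
        using \<mu>\<eta> by (rule is_prefix_trans)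
      moreover have "\<not> is_prefix G (\<alpha> \<cdot> \<beta>) \<eta>" if "\<beta> \<in> F" for \<beta>
      proof
        assume *: "is_prefix G (\<alpha> \<cdot> \<beta>) \<eta>"
        have ne: "\<not> is_prefix G (\<alpha> \<cdot> \<beta>) \<mu>"
          using Basis(2) s(1) that by (auto simp: mem_cylinder)
        then have "is_prefix G \<mu> (\<alpha> \<cdot> \<beta>)"
          using is_prefix_comparable[OF * \<mu>\<eta>] by blast
        then obtain \<rho> where \<rho>: "composable G \<mu> \<rho>" "\<alpha> \<cdot> \<beta> = \<mu> \<cdot> \<rho>"
          by (rule is_prefixE)
        moreover have "\<rho> \<noteq> vpath (psource G \<mu>)"
          using \<rho> ne assms(3) pconc_vpath is_prefix_refl by metis
        ultimately obtain e where "e \<in> edges_at G (psource G \<mu>)" "is_prefix G (epath G e) \<rho>"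
          using epath_split by metis
        then have "P \<beta> e"
          using is_prefix_pconc_mono[OF composable_epath(1)[OF assms(3)]] \<rho>(2) by (simp add: P_def)
        then have "\<exists>e. P \<beta> e" ..
        then have "(SOME e. P \<beta> e) \<in> F'" "P \<beta> (SOME e. P \<beta> e)"
          using P[of \<beta>] that by (simp_all add: F'_def)
        then obtain f where "f \<in> F'" "P \<beta> f" ..
        then have "is_prefix G (\<mu> \<cdot> epath G f) \<eta>"
          using is_prefix_trans[OF _ *] by (simp add: P_def)
        then show False
          using \<eta> \<open>f \<in> F'\<close> by (auto simp: N_def mem_cylinder)
      qed
      ultimately show "\<eta> \<in> s"
        by (auto simp: s(1) mem_cylinder)
    qed
    ultimately show ?case
      by blast
  qed simp
  then show ?thesis
    using that unfolding N_def by blast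
qed

text \<open>The two prefixes have equal length, so they coincide. The sets Z(\<mu>e) are therefore
  pairwise disjoint, and removing some of them leaves the others intact.\<close>

lemma is_prefix_epath_unique:
  assumes "\<mu> \<in> fin_paths G" "is_prefix G (\<mu> \<cdot> epath G e) \<xi>" "is_prefix G (\<mu> \<cdot> epath G f) \<xi>"
  shows "e = f"
proof -
  obtain v es where "\<mu> = FPath v es"
    using assms(1) by (rule fin_pathsE)
  moreover have "\<mu> \<cdot> epath G e = \<mu> \<cdot> epath G f"
    using is_prefix_plength_le[OF assms(2,3)] is_prefix_plength_le[OF assms(3,2)] calculation
    by (intro is_prefix_antisym) simp_all
  ultimately show ?thesis
    by simp
qed

end

section \<open>The action on paths\<close>

lemma act_list_append: "act_list G g (es @ fs) = act_list G g es @ act_list G (res_list G g es) fs"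
  by (induction es arbitrary: g) simp_all

lemma res_list_append: "res_list G g (es @ fs) = res_list G (res_list G g es) fs"
  by (induction es arbitrary: g) simp_all

lemma length_act_list [simp]: "length (act_list G g es) = length es"
  by (induction es arbitrary: g) simp_all

text \<open>The vertex \<open>u\<close> is arbitrary because a list concatenated with a word forgets
  its base vertex. In the induction the two words are compared letter by letter: past index 0 the
  acting element has already been restricted along \<open>e\<close>.\<close>

lemma pact_IPath_conc:
  "pact G g (IPath (es \<frown> w)) = FPath u (act_list G g es) \<cdot> pact G (res_list G g es) (IPath w)"
proof (induction es arbitrary: g)
  case (Cons e es)
  define x where "x = es \<frown> w"
  have "(\<lambda>n. eact G (res_list G g (map (e ## x) [0..<n])) ((e ## x) n)) =
      eact G g e ## (\<lambda>n. eact G (res_list G (eres G g e) (map x [0..<n])) (x n))"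
  proof
    fix n show "eact G (res_list G g (map (e ## x) [0..<n])) ((e ## x) n) =
      (eact G g e ## (\<lambda>n. eact G (res_list G (eres G g e) (map x [0..<n])) (x n))) n"
    proof (cases n)
      case (Suc m)
      have "map (e ## x) [0..<Suc m] = e # map x [0..<m]"
        by (simp add: map_upt_Suc del: upt_Suc)
      then show ?thesis
        using Suc by (simp del: upt_Suc)
    qed simp
  qed
  then show ?case
    using Cons[of "eres G g e"] by (simp flip: x_def)
qed simp

lemma pact_pconc: "pact G g (FPath v es \<cdot> \<xi>) = pact G g (FPath v es) \<cdot> pact G (pres G g (FPath v es)) \<xi>"
  by (cases \<xi>) (simp_all add: act_list_append pact_IPath_conc[of _ _ _ _ "grange G g"] del: pact.simps(2))

lemma pres_pconc: "pres G g (FPath v es \<cdot> FPath u fs) = pres G (pres G g (FPath v es)) (FPath u fs)"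
  by (simp add: res_list_append)

context self_similar_action
begin

section \<open>Units act trivially\<close>

lemma vertex_unit:
  assumes "v \<in> verts E"
  shows "v \<in> arrows G" "grange G v = v" "gsource G v = v"
  using assms unfolding units_eq_verts[symmetric] gunits_def
  by (auto simp: source_closed range_source source_source)

text \<open>An inverse of \<open>x\<close> cancels one factor in \<open>x x = x\<close>.\<close>

lemma idempotent_eq_source:
  assumes "x \<in> arrows G" "gsource G x = grange G x" "gcomp G x x = x"
  shows "x = gsource G x"
proof -
  obtain y where y: "y \<in> arrows G" "gsource G y = grange G x" "gcomp G y x = gsource G x"
    using inverse_exists[OF assms(1)] by blast
  have "gcomp G (gcomp G y x) x = gcomp G y (gcomp G x x)"
    using comp_assoc[OF y(1) assms(1,1) y(2) assms(2)] .
  then show ?thesis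
    using y assms range_unit[OF assms(1)] by metis
qed

text \<open>The axioms prescribe only source and range of the restriction of a unit. From vv = v and
  ve = e it is idempotent, hence a unit, and its source identifies it.\<close>

lemma eres_vertex:
  assumes "e \<in> arcs E"
  shows "eres G (head E e) e = tail E e"
proof -
  define v where "v = head E e"
  have v: "v \<in> arrows G" "grange G v = v" "gsource G v = v"
    using vertex_unit[of v] assms by (simp_all add: v_def)
  have act: "eact G v e = e" and comp: "gcomp G v v = v"
    using unit_act assms range_unit[OF v(1)] v by (simp_all add: v_def)
  have src: "gsource G (eres G v e) = tail E e" "grange G (eres G v e) = tail E e"
    using source_res[OF v(1) assms] range_res[OF v(1) assms] v act by (simp_all add: v_def)
  have "gcomp G (eres G v e) (eres G v e) = eres G v e"
    using comp_res[OF v(1,1) _ assms] v comp act by (simp add: v_def)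
  then show ?thesis
    using idempotent_eq_source[OF res_closed[OF v(1) assms]] v(3) src by (simp add: v_def)
qed

lemma act_res_list_vertex:
  "FPath v es \<in> fin_paths E \<Longrightarrow> act_list G v es = es \<and> res_list G v es = psource E (FPath v es)"
proof (induction es arbitrary: v)
  case (Cons e es)
  then have "e \<in> arcs E" "head E e = v" "FPath (tail E e) es \<in> fin_paths E"
    by (simp_all add: Cons_mem_fin_paths)
  then show ?case
    using Cons.IH[of "tail E e"] eres_vertex unit_act by (auto simp: psource_Cons)
qed simp

lemma pres_vertex: "\<nu> \<in> fin_paths E \<Longrightarrow> pres G (prange E \<nu>) \<nu> = psource E \<nu>"
  using act_res_list_vertex by (metis fin_pathsE pres.simps(1) prange.simps(1))

lemma pact_vertex:
  assumes "\<xi> \<in> path_space E"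
  shows "pact G (prange E \<xi>) \<xi> = \<xi>"
proof (cases \<xi>)
  case (FPath v es)
  then have "FPath v es \<in> fin_paths E"
    using assms by (auto simp: path_space_def inf_paths_def)
  then show ?thesis
    using FPath act_res_list_vertex vertex_unit(2) path_space_prange[OF assms] by simp
next
  case (IPath w)
  then have w: "w i \<in> arcs E" "tail E (w i) = head E (w (Suc i))" for i
    using assms by (auto simp: path_space_def inf_paths_def fin_paths_def)
  have "res_list G (head E (w 0)) (map w [0..<n]) = head E (w n)" for n
    by (induction n) (use w eres_vertex in \<open>auto simp: res_list_append\<close>)
  then show ?thesis
    using IPath w unit_act by simp
qed

end

section \<open>Germs\<close>

text \<open>The finite path \<nu> = \<beta>\<beta>' = \<delta>\<delta>', hidden under the
  quantifiers of the germ relation, is made a parameter. Agreement at \<nu> can then be moved to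
  longer paths and used for every \<xi> with prefix \<nu>.\<close>

definition germ_eq_at ::
    "('g, 'e) ss_groupoid \<Rightarrow> ('g, 'e) pre_digraph \<Rightarrow> ('g, 'e) path \<times> 'g \<times> ('g, 'e) path \<Rightarrow>
     ('g, 'e) path \<times> 'g \<times> ('g, 'e) path \<Rightarrow> ('g, 'e) path \<Rightarrow> bool"
  where "germ_eq_at G E = (\<lambda>(\<alpha>, g, \<beta>) (\<gamma>, h, \<delta>) \<nu>. \<exists>\<beta>'\<in>fin_paths E. \<exists>\<delta>'\<in>fin_paths E.
           composable E \<beta> \<beta>' \<and> composable E \<delta> \<delta>' \<and> \<nu> = \<beta> \<cdot> \<beta>' \<and> \<nu> = \<delta> \<cdot> \<delta>' \<and>
           \<alpha> \<cdot> pact G g \<beta>' = \<gamma> \<cdot> pact G h \<delta>' \<and> pres G g \<beta>' = pres G h \<delta>')"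

lemma germ_eq_atI:
  assumes "\<beta>' \<in> fin_paths E" "\<delta>' \<in> fin_paths E" "composable E \<beta> \<beta>'" "composable E \<delta> \<delta>'"
    and "\<nu> = \<beta> \<cdot> \<beta>'" "\<nu> = \<delta> \<cdot> \<delta>'" "\<alpha> \<cdot> pact G g \<beta>' = \<gamma> \<cdot> pact G h \<delta>'" "pres G g \<beta>' = pres G h \<delta>'"
  shows "germ_eq_at G E (\<alpha>, g, \<beta>) (\<gamma>, h, \<delta>) \<nu>"
  unfolding germ_eq_at_def prod.case using assms by blast

lemma germ_eq_at_sym: "germ_eq_at G E s t \<nu> \<Longrightarrow> germ_eq_at G E t s \<nu>"
  unfolding germ_eq_at_def by (cases s; cases t) (simp; metis)

context self_similar_action
begin

lemma germ_eq_at_refl: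
  assumes "is_prefix E \<beta> \<nu>" "\<nu> \<in> fin_paths E"
  shows "germ_eq_at G E (\<alpha>, g, \<beta>) (\<alpha>, g, \<beta>) \<nu>"
proof -
  obtain \<beta>' where "composable E \<beta> \<beta>'" "\<nu> = \<beta> \<cdot> \<beta>'" "\<beta>' \<in> fin_paths E"
    using is_prefix_fin_pathsE[OF assms] by metis
  then show ?thesis
    by (intro germ_eq_atI[of \<beta>' _ \<beta>']) auto
qed

text \<open>At a common \<nu> the two factors completing \<delta> to \<nu> coincide by cancellation,
  so the two agreements can be chained.\<close>

lemma germ_eq_at_trans:
  assumes "germ_eq_at G E s t \<nu>" "germ_eq_at G E t u \<nu>"
  shows "germ_eq_at G E s u \<nu>"
proof -
  obtain \<alpha> g \<beta> \<gamma> h \<delta> \<epsilon> k \<zeta> where stu: "s = (\<alpha>, g, \<beta>)" "t = (\<gamma>, h, \<delta>)" "u = (\<epsilon>, k, \<zeta>)"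
    by (metis surj_pair)
  obtain \<beta>' \<delta>' where 1: "\<beta>' \<in> fin_paths E" "composable E \<beta> \<beta>'" "composable E \<delta> \<delta>'" "\<nu> = \<beta> \<cdot> \<beta>'"
      "\<nu> = \<delta> \<cdot> \<delta>'" "\<alpha> \<cdot> pact G g \<beta>' = \<gamma> \<cdot> pact G h \<delta>'" "pres G g \<beta>' = pres G h \<delta>'"
    using assms(1) by (auto simp: stu germ_eq_at_def)
  obtain \<delta>'' \<zeta>' where 2: "\<zeta>' \<in> fin_paths E" "composable E \<delta> \<delta>''" "composable E \<zeta> \<zeta>'" "\<nu> = \<delta> \<cdot> \<delta>''"
      "\<nu> = \<zeta> \<cdot> \<zeta>'" "\<gamma> \<cdot> pact G h \<delta>'' = \<epsilon> \<cdot> pact G k \<zeta>'" "pres G h \<delta>'' = pres G k \<zeta>'"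
    using assms(2) by (auto simp: stu germ_eq_at_def)
  have "\<delta>' = \<delta>''"
    using pconc_cancel 1(3,5) 2(2,4) by metis
  then show ?thesis
    using 1 2 unfolding stu by (intro germ_eq_atI[of \<beta>' _ \<zeta>']) auto
qed

lemma pconc_pact_pconc:
  assumes "\<alpha> \<in> fin_paths E" "\<beta> \<in> fin_paths E"
  shows "\<alpha> \<cdot> pact G g (\<beta> \<cdot> \<xi>) = (\<alpha> \<cdot> pact G g \<beta>) \<cdot> pact G (pres G g \<beta>) \<xi>"
proof -
  obtain v es u fs where "\<alpha> = FPath v es" "\<beta> = FPath u fs"
    using assms fin_pathsE by metis
  then show ?thesis
    by (cases "pact G (pres G g \<beta>) \<xi>") (simp_all add: pact_pconc)
qed

text \<open>Beyond \<nu> both triples act by the same restriction, so a further factor \<rho> is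
  moved in the same way and leaves the same restriction behind.\<close>

lemma germ_eq_at_extend:
  assumes "germ_eq_at G E (\<alpha>, g, \<beta>) (\<gamma>, h, \<delta>) \<nu>" "is_prefix E \<nu> \<nu>'" "\<nu>' \<in> fin_paths E"
    and "\<alpha> \<in> fin_paths E" "\<gamma> \<in> fin_paths E"
  shows "germ_eq_at G E (\<alpha>, g, \<beta>) (\<gamma>, h, \<delta>) \<nu>'"
proof -
  obtain \<beta>' \<delta>' where 1: "\<beta>' \<in> fin_paths E" "\<delta>' \<in> fin_paths E" "composable E \<beta> \<beta>'" "composable E \<delta> \<delta>'"
      "\<nu> = \<beta> \<cdot> \<beta>'" "\<nu> = \<delta> \<cdot> \<delta>'" "\<alpha> \<cdot> pact G g \<beta>' = \<gamma> \<cdot> pact G h \<delta>'" "pres G g \<beta>' = pres G h \<delta>'"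
    using assms(1) by (auto simp: germ_eq_at_def)
  obtain \<rho> where \<rho>: "composable E \<nu> \<rho>" "\<nu>' = \<nu> \<cdot> \<rho>" "\<rho> \<in> fin_paths E"
    using is_prefix_fin_pathsE[OF assms(2,3)] by metis
  have comp: "composable E \<beta>' \<rho>" "composable E \<delta>' \<rho>"
    using \<rho>(1) composable_pconc 1 by metis+
  have "\<nu>' = \<beta> \<cdot> \<beta>' \<cdot> \<rho>" "\<nu>' = \<delta> \<cdot> \<delta>' \<cdot> \<rho>"
    using \<rho>(2) 1 pconc_assoc composableD(1) by metis+
  moreover have "\<beta>' \<cdot> \<rho> \<in> fin_paths E" "\<delta>' \<cdot> \<rho> \<in> fin_paths E"
    using comp \<rho>(3) pconc_mem_fin_paths_iff by auto
  moreover have "composable E \<beta> (\<beta>' \<cdot> \<rho>)" "composable E \<delta> (\<delta>' \<cdot> \<rho>)"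
    using composable_pconc_right 1(3,4) comp by auto
  moreover have "\<alpha> \<cdot> pact G g (\<beta>' \<cdot> \<rho>) = \<gamma> \<cdot> pact G h (\<delta>' \<cdot> \<rho>)"
    using pconc_pact_pconc assms(4,5) 1(1,2,7,8) by simp
  moreover have "pres G g (\<beta>' \<cdot> \<rho>) = pres G h (\<delta>' \<cdot> \<rho>)"
    using 1(1,2,8) \<rho>(3) by (auto elim!: fin_pathsE simp: res_list_append)
  ultimately show ?thesis
    by (intro germ_eq_atI[of "\<beta>' \<cdot> \<rho>" _ "\<delta>' \<cdot> \<rho>"])
qed

section \<open>The germ relation, sources and ranges\<close>

lemma germ_reps_iff:
  "(\<alpha>, g, \<beta>, \<xi>) \<in> germ_reps G E \<longleftrightarrow> (\<alpha>, g, \<beta>) \<in> germ_triples G E \<and> is_prefix E \<beta> \<xi>"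
  by (simp add: germ_reps_def mem_cylinder)

lemma germ_triplesD:
  assumes "(\<alpha>, g, \<beta>) \<in> germ_triples G E"
  shows "\<alpha> \<in> fin_paths E" "\<beta> \<in> fin_paths E" "g \<in> arrows G" "grange G g = psource E \<alpha>"
    "gsource G g = psource E \<beta>"
  using assms by (auto simp: germ_triples_def)

lemma germ_rel_iff:
  "((\<alpha>, g, \<beta>, \<xi>), (\<gamma>, h, \<delta>, \<eta>)) \<in> germ_rel G E \<longleftrightarrow>
     (\<alpha>, g, \<beta>, \<xi>) \<in> germ_reps G E \<and> (\<gamma>, h, \<delta>, \<eta>) \<in> germ_reps G E \<and> \<xi> = \<eta> \<and>
     (\<exists>\<nu>. is_prefix E \<nu> \<xi> \<and> germ_eq_at G E (\<alpha>, g, \<beta>) (\<gamma>, h, \<delta>) \<nu>)"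
  unfolding germ_rel_def germ_eq_at_def by auto

lemma equiv_germ_rel: "equiv (germ_reps G E) (germ_rel G E)"
proof (rule equivI)
  show "germ_rel G E \<subseteq> germ_reps G E \<times> germ_reps G E"
    by (auto simp: germ_rel_def)
  show "refl_on (germ_reps G E) (germ_rel G E)"
  proof (rule refl_onI)
    fix r assume r: "r \<in> germ_reps G E"
    obtain \<alpha> g \<beta> \<xi> where eq: "r = (\<alpha>, g, \<beta>, \<xi>)"
      by (metis surj_pair)
    then have "is_prefix E \<beta> \<xi>" "\<beta> \<in> fin_paths E"
      using r is_prefixD by (auto simp: germ_reps_iff)
    then show "(r, r) \<in> germ_rel G E"
      using r germ_eq_at_refl is_prefix_refl unfolding eq germ_rel_iff by blast
  qed
  show "sym (germ_rel G E)"
  proof (rule symI)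
    fix r s assume "(r, s) \<in> germ_rel G E"
    then show "(s, r) \<in> germ_rel G E"
      using germ_eq_at_sym by (cases r; cases s) (fastforce simp: germ_rel_iff)
  qed
  show "trans (germ_rel G E)"
  proof (rule transI)
    fix r s t assume rs: "(r, s) \<in> germ_rel G E" and st: "(s, t) \<in> germ_rel G E"
    obtain \<alpha> g \<beta> \<xi> \<gamma> h \<delta> \<eta> \<epsilon> k \<zeta> \<theta> where
      eqs: "r = (\<alpha>, g, \<beta>, \<xi>)" "s = (\<gamma>, h, \<delta>, \<eta>)" "t = (\<epsilon>, k, \<zeta>, \<theta>)"
      by (metis surj_pair)
    obtain \<nu> \<nu>' where \<nu>: "is_prefix E \<nu> \<xi>" "germ_eq_at G E (\<alpha>, g, \<beta>) (\<gamma>, h, \<delta>) \<nu>"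
        "is_prefix E \<nu>' \<xi>" "germ_eq_at G E (\<gamma>, h, \<delta>) (\<epsilon>, k, \<zeta>) \<nu>'" "\<xi> = \<eta>" "\<eta> = \<theta>"
      using rs st unfolding eqs germ_rel_iff by blast
    have fin: "\<alpha> \<in> fin_paths E" "\<gamma> \<in> fin_paths E" "\<epsilon> \<in> fin_paths E"
      using rs st unfolding eqs germ_rel_iff germ_reps_iff by (auto dest: germ_triplesD)
    \<comment> \<open>The two agreements happen at prefixes of the same path. The one at the shorter
      prefix is carried to the longer, where they compose.\<close>
    consider "is_prefix E \<nu> \<nu>'" | "is_prefix E \<nu>' \<nu>"
      using is_prefix_comparable[OF \<nu>(1,3)] by blast
    then have "\<exists>\<kappa>. is_prefix E \<kappa> \<xi> \<and> germ_eq_at G E (\<alpha>, g, \<beta>) (\<epsilon>, k, \<zeta>) \<kappa>"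
    proof cases
      case 1
      then show ?thesis
        using germ_eq_at_extend[OF \<nu>(2) 1 is_prefixD(1)[OF \<nu>(3)] fin(1,2)] germ_eq_at_trans \<nu> by blast
    next
      case 2
      then show ?thesis
        using germ_eq_at_extend[OF \<nu>(4) 2 is_prefixD(1)[OF \<nu>(1)] fin(2,3)] germ_eq_at_trans \<nu> by blast
    qed
    then show "(r, t) \<in> germ_rel G E"
      using rs st unfolding eqs germ_rel_iff by auto
  qed
qed

lemma germ_eq_iff:
  assumes "(\<alpha>, g, \<beta>, \<xi>) \<in> germ_reps G E" "(\<gamma>, h, \<delta>, \<eta>) \<in> germ_reps G E"
  shows "germ G E \<alpha> g \<beta> \<xi> = germ G E \<gamma> h \<delta> \<eta> \<longleftrightarrow>
    \<xi> = \<eta> \<and> (\<exists>\<nu>. is_prefix E \<nu> \<xi> \<and> germ_eq_at G E (\<alpha>, g, \<beta>) (\<gamma>, h, \<delta>) \<nu>)"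
  using eq_equiv_class_iff[OF equiv_germ_rel assms] assms unfolding germ_def germ_rel_iff by blast

lemma germ_mem_germs: "(\<alpha>, g, \<beta>, \<xi>) \<in> germ_reps G E \<Longrightarrow> germ G E \<alpha> g \<beta> \<xi> \<in> germs G E"
  by (simp add: germ_def germs_def quotientI)

lemma germsE:
  assumes "c \<in> germs G E"
  obtains \<alpha> g \<beta> \<xi> where "(\<alpha>, g, \<beta>, \<xi>) \<in> germ_reps G E" "c = germ G E \<alpha> g \<beta> \<xi>"
  using assms unfolding germs_def germ_def by (elim quotientE) force

lemma mem_germ_iff: "(\<gamma>, h, \<delta>, \<eta>) \<in> germ G E \<alpha> g \<beta> \<xi> \<longleftrightarrow>
    ((\<alpha>, g, \<beta>, \<xi>), (\<gamma>, h, \<delta>, \<eta>)) \<in> germ_rel G E"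
  by (simp add: germ_def)

lemma self_mem_germ: "(\<alpha>, g, \<beta>, \<xi>) \<in> germ_reps G E \<Longrightarrow> (\<alpha>, g, \<beta>, \<xi>) \<in> germ G E \<alpha> g \<beta> \<xi>"
  unfolding germ_def by (rule equiv_class_self[OF equiv_germ_rel])

lemma germ_source_germ:
  assumes "(\<alpha>, g, \<beta>, \<xi>) \<in> germ_reps G E"
  shows "germ_source E (germ G E \<alpha> g \<beta> \<xi>) = \<xi>"
  unfolding germ_source_def
proof (rule the_equality)
  obtain \<zeta> where "composable E \<beta> \<zeta>" "\<xi> = \<beta> \<cdot> \<zeta>"
    using assms is_prefixE by (metis germ_reps_iff)
  then show "\<exists>\<alpha>' g' \<beta>' \<xi>'. (\<alpha>', g', \<beta>', \<beta>' \<cdot> \<xi>') \<in> germ G E \<alpha> g \<beta> \<xi> \<and> composable E \<beta>' \<xi>' \<and> \<xi> = \<beta>' \<cdot> \<xi>'"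
    using self_mem_germ[OF assms] by blast
qed (auto simp: mem_germ_iff germ_rel_iff)

text \<open>The description is definite because two representatives that agree at a prefix leave a
  common tail \<rho> and move it by the same restriction.\<close>

lemma germ_range_germ:
  assumes "(\<alpha>, g, \<beta>, \<beta> \<cdot> \<zeta>) \<in> germ_reps G E" "composable E \<beta> \<zeta>"
  shows "germ_range G E (germ G E \<alpha> g \<beta> (\<beta> \<cdot> \<zeta>)) = \<alpha> \<cdot> pact G g \<zeta>"
  unfolding germ_range_def
proof (rule the_equality)
  show "\<exists>\<alpha>' g' \<beta>' \<xi>'. (\<alpha>', g', \<beta>', \<beta>' \<cdot> \<xi>') \<in> germ G E \<alpha> g \<beta> (\<beta> \<cdot> \<zeta>) \<and> composable E \<beta>' \<xi>' \<and>
      \<alpha> \<cdot> pact G g \<zeta> = \<alpha>' \<cdot> pact G g' \<xi>'"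
    using self_mem_germ[OF assms(1)] assms(2) by blast
next
  fix \<theta>
  assume "\<exists>\<alpha>' g' \<beta>' \<xi>'. (\<alpha>', g', \<beta>', \<beta>' \<cdot> \<xi>') \<in> germ G E \<alpha> g \<beta> (\<beta> \<cdot> \<zeta>) \<and> composable E \<beta>' \<xi>' \<and>
      \<theta> = \<alpha>' \<cdot> pact G g' \<xi>'"
  then obtain \<gamma> h \<delta> \<eta> where h: "((\<alpha>, g, \<beta>, \<beta> \<cdot> \<zeta>), (\<gamma>, h, \<delta>, \<delta> \<cdot> \<eta>)) \<in> germ_rel G E" "composable E \<delta> \<eta>"
      "\<theta> = \<gamma> \<cdot> pact G h \<eta>"
    by (auto simp: mem_germ_iff)
  have eq: "\<beta> \<cdot> \<zeta> = \<delta> \<cdot> \<eta>"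
    using h(1) by (simp add: germ_rel_iff)
  have fin: "\<alpha> \<in> fin_paths E" "\<gamma> \<in> fin_paths E" "\<beta> \<in> fin_paths E" "\<delta> \<in> fin_paths E"
    using h(1) unfolding germ_rel_iff germ_reps_iff by (auto dest: germ_triplesD)
  obtain \<beta>' \<delta>' where 1: "\<beta>' \<in> fin_paths E" "\<delta>' \<in> fin_paths E" "composable E \<beta> \<beta>'" "composable E \<delta> \<delta>'"
      "\<beta> \<cdot> \<beta>' = \<delta> \<cdot> \<delta>'" "\<alpha> \<cdot> pact G g \<beta>' = \<gamma> \<cdot> pact G h \<delta>'" "pres G g \<beta>' = pres G h \<delta>'"
      "is_prefix E (\<beta> \<cdot> \<beta>') (\<beta> \<cdot> \<zeta>)"
    using h(1) unfolding germ_rel_iff germ_eq_at_def by auto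
  obtain \<rho> where \<rho>: "composable E (\<beta> \<cdot> \<beta>') \<rho>" "\<beta> \<cdot> \<zeta> = (\<beta> \<cdot> \<beta>') \<cdot> \<rho>"
    using 1(8) by (rule is_prefixE)
  have comp: "composable E \<beta>' \<rho>" "composable E \<delta>' \<rho>"
    using \<rho>(1) composable_pconc 1 by metis+
  have "\<beta> \<cdot> \<zeta> = \<beta> \<cdot> \<beta>' \<cdot> \<rho>" "\<delta> \<cdot> \<eta> = \<delta> \<cdot> \<delta>' \<cdot> \<rho>"
    using \<rho>(2) pconc_assoc fin(3,4) 1(1,2,5) eq by metis+
  then have "\<zeta> = \<beta>' \<cdot> \<rho>" "\<eta> = \<delta>' \<cdot> \<rho>"
    using pconc_cancel composable_pconc_right 1(3,4) comp assms(2) h(2) by metis+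
  then show "\<theta> = \<alpha> \<cdot> pact G g \<zeta>"
    using h(3) pconc_pact_pconc fin 1 by simp
qed

section \<open>Strongly fixed paths and the unit space\<close>

lemma unit_germ_rep:
  assumes "\<xi> \<in> path_space E"
  shows "(vpath (prange E \<xi>), prange E \<xi>, vpath (prange E \<xi>), \<xi>) \<in> germ_reps G E"
  using path_space_prange[OF assms] vertex_unit[of "prange E \<xi>"] is_prefix_vpath[OF assms]
  by (simp add: germ_reps_iff germ_triples_def)

lemma fin_strongly_fixedD:
  assumes "fin_strongly_fixed G E g \<mu>"
  shows "\<mu> \<in> fin_paths E" "prange E \<mu> = gsource G g" "pact G g \<mu> = \<mu>" "pres G g \<mu> = psource E \<mu>"
  using assms by (auto simp: fin_strongly_fixed_def)

text \<open>Along \<nu> the element g has been restricted to a unit, which fixes whatever follows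
  and restricts to units.\<close>

lemma fin_strongly_fixed_extend:
  assumes "fin_strongly_fixed G E g \<nu>" "is_prefix E \<nu> \<xi>"
  shows "pact G g \<xi> = \<xi>" "\<xi> \<in> fin_paths E \<Longrightarrow> fin_strongly_fixed G E g \<xi>"
proof -
  note \<nu> = fin_strongly_fixedD[OF assms(1)]
  obtain \<rho> where \<rho>: "composable E \<nu> \<rho>" "\<xi> = \<nu> \<cdot> \<rho>"
    using assms(2) by (rule is_prefixE)
  obtain v es where eq: "\<nu> = FPath v es"
    using \<nu>(1) by (rule fin_pathsE)
  have "pact G g \<xi> = pact G g \<nu> \<cdot> pact G (pres G g \<nu>) \<rho>"
    unfolding \<rho>(2) eq by (rule pact_pconc)
  also have "\<dots> = \<xi>"
    using \<nu> \<rho> pact_vertex[OF composableD(2)[OF \<rho>(1)]] composableD(3)[OF \<rho>(1)] by simp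
  finally show "pact G g \<xi> = \<xi>" .
  assume \<xi>: "\<xi> \<in> fin_paths E"
  then have fin: "\<rho> \<in> fin_paths E"
    using \<rho> pconc_mem_fin_paths_iff by metis
  then obtain u fs where "\<rho> = FPath u fs"
    by (rule fin_pathsE)
  then have "pres G g \<xi> = pres G (pres G g \<nu>) \<rho>"
    unfolding \<rho>(2) eq by (simp only: pres_pconc)
  also have "\<dots> = psource E \<rho>"
    using \<nu>(4) pres_vertex[OF fin] composableD(3)[OF \<rho>(1)] by simp
  also have "\<dots> = psource E \<xi>"
    using psource_pconc[OF \<rho>(1)] \<rho>(2) by simp
  finally show "fin_strongly_fixed G E g \<xi>"
    using \<open>pact G g \<xi> = \<xi>\<close> \<xi> \<nu>(2) is_prefixD(3)[OF assms(2)] by (simp add: fin_strongly_fixed_def)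
qed

text \<open>The definition uses prefixes only for infinite paths. Since strong fixedness passes to
  extensions, the same criterion holds for finite ones, and the two kinds need not be distinguished
  any more.\<close>

lemma strongly_fixed_iff:
  assumes "\<xi> \<in> path_space E"
  shows "strongly_fixed G E g \<xi> \<longleftrightarrow> (\<exists>\<nu>. is_prefix E \<nu> \<xi> \<and> fin_strongly_fixed G E g \<nu>)"
proof
  assume "strongly_fixed G E g \<xi>"
  then show "\<exists>\<nu>. is_prefix E \<nu> \<xi> \<and> fin_strongly_fixed G E g \<nu>"
    using is_prefix_refl fin_strongly_fixedD(1) unfolding strongly_fixed_def by blast
next
  assume "\<exists>\<nu>. is_prefix E \<nu> \<xi> \<and> fin_strongly_fixed G E g \<nu>"
  then show "strongly_fixed G E g \<xi>"
    using fin_strongly_fixed_extend(2) assms unfolding strongly_fixed_def path_space_def by blast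
qed

lemma strongly_fixed_path_space: "strongly_fixed G E g \<xi> \<Longrightarrow> \<xi> \<in> path_space E"
  by (auto simp: strongly_fixed_def path_space_def dest: fin_strongly_fixedD)

lemma strongly_fixed_mono:
  assumes "fin_strongly_fixed G E g \<nu>" "is_prefix E \<nu> \<xi>"
  shows "strongly_fixed G E g \<xi>"
  using strongly_fixed_iff is_prefixD(2) assms by blast

text \<open>The longer of \<nu> and a strongly fixed prefix of \<eta> will do. Possibly infinite
  fixed extensions are thereby replaced by finite ones, which have cylinders.\<close>

lemma strongly_fixed_prefix:
  assumes "strongly_fixed G E g \<eta>" "is_prefix E \<nu> \<eta>"
  obtains \<kappa> where "fin_strongly_fixed G E g \<kappa>" "is_prefix E \<nu> \<kappa>"
proof -
  obtain \<kappa> where \<kappa>: "is_prefix E \<kappa> \<eta>" "fin_strongly_fixed G E g \<kappa>"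
    using assms(1) strongly_fixed_iff strongly_fixed_path_space by blast
  consider "is_prefix E \<nu> \<kappa>" | "is_prefix E \<kappa> \<nu>"
    using is_prefix_comparable[OF assms(2) \<kappa>(1)] by blast
  then show ?thesis
  proof cases
    case 2
    then show ?thesis
      using that[of \<nu>] fin_strongly_fixed_extend(2)[OF \<kappa>(2) 2] is_prefixD(1)[OF assms(2)] is_prefix_refl
      by blast
  qed (use \<kappa> that in blast)
qed

text \<open>The action preserves length and is computed from the left, so g\<nu> is the initial
  segment of g\<kappa> = \<kappa> of the length of \<nu>.\<close>

lemma pact_fixed_prefix:
  assumes "fin_strongly_fixed G E g \<kappa>" "is_prefix E \<nu> \<kappa>"
  shows "pact G g \<nu> = \<nu>"
proof -
  note \<kappa> = fin_strongly_fixedD[OF assms(1)]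
  obtain \<rho> where \<rho>: "composable E \<nu> \<rho>" "\<kappa> = \<nu> \<cdot> \<rho>" "\<rho> \<in> fin_paths E"
    using is_prefix_fin_pathsE[OF assms(2) \<kappa>(1)] by metis
  obtain v es u fs where "\<nu> = FPath v es" "\<rho> = FPath u fs"
    using composableD(1)[OF \<rho>(1)] \<rho>(3) fin_pathsE by metis
  then show ?thesis
    using \<kappa>(3) \<rho>(2) by (simp add: act_list_append)
qed

lemma pact_fixed_inf_path:
  assumes "\<xi> \<in> inf_paths E" "\<And>\<nu>. is_prefix E \<nu> \<xi> \<Longrightarrow> pact G g \<nu> = \<nu>"
  shows "pact G g \<xi> = \<xi>"
proof -
  obtain w where w: "\<xi> = IPath w"
    using assms(1) by (auto simp: inf_paths_def)
  define w' where "w' = (\<lambda>n. eact G (res_list G g (map w [0..<n])) (w n))"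
  have w': "pact G g \<xi> = IPath w'"
    by (simp add: w w'_def)
  have "w' n = w n" for n
  proof -
    obtain \<nu> where \<nu>: "is_prefix E \<nu> \<xi>" "plength \<nu> = Suc n"
      using inf_paths_prefix_plength[OF assms(1)] by metis
    obtain v es where eq: "\<nu> = FPath v es"
      using fin_pathsE is_prefixD(1)[OF \<nu>(1)] by metis
    obtain \<rho> where \<rho>: "\<xi> = \<nu> \<cdot> \<rho>"
      using \<nu>(1) by (rule is_prefixE)
    have "pact G g \<xi> = \<nu> \<cdot> pact G (pres G g \<nu>) \<rho>"
      using pact_pconc[of G g v es \<rho>] assms(2)[OF \<nu>(1)] unfolding \<rho> eq by simp
    moreover obtain x where x: "\<rho> = IPath x" "w = es \<frown> x"
      using \<rho> w eq by (cases \<rho>) auto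
    ultimately obtain y where "w' = es \<frown> y"
      using w' eq x(1) by simp
    then show ?thesis
      using \<nu>(2) eq x(2) by simp
  qed
  then show ?thesis
    using w w' by auto
qed

text \<open>The factor completing the triple of the unit to \<beta>\<beta>' is \<beta>\<beta>'
  itself, on which the unit acts trivially. Agreement there therefore says that \<alpha>(g\<beta>')
  = \<beta>\<beta>' and that g restricts along \<beta>' to s(\<beta>'). Conversely, a strongly fixed
  prefix \<nu> of \<zeta> gives agreement at \<beta>\<nu>.\<close>

lemma germ_eq_unit_germ_iff:
  assumes "(\<alpha>, g, \<beta>) \<in> germ_triples G E" "composable E \<beta> \<zeta>"
  shows "germ G E \<alpha> g \<beta> (\<beta> \<cdot> \<zeta>) = unit_germ G E (\<beta> \<cdot> \<zeta>) \<longleftrightarrow> \<alpha> = \<beta> \<and> strongly_fixed G E g \<zeta>"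
proof -
  define v where "v = prange E \<beta>"
  note tri = germ_triplesD[OF assms(1)]
  have \<xi>: "\<beta> \<cdot> \<zeta> \<in> path_space E" "prange E (\<beta> \<cdot> \<zeta>) = v"
    using pconc_mem_path_space[OF assms(2)] prange_pconc[OF assms(2)] by (simp_all add: v_def)
  have v: "v \<in> verts E" "grange G v = v"
    using path_space_prange[OF \<xi>(1)] \<xi>(2) vertex_unit by auto
  have reps: "(\<alpha>, g, \<beta>, \<beta> \<cdot> \<zeta>) \<in> germ_reps G E" "(vpath v, v, vpath v, \<beta> \<cdot> \<zeta>) \<in> germ_reps G E"
    using unit_germ_rep[OF \<xi>(1)] \<xi>(2) assms is_prefix_pconc by (auto simp: germ_reps_iff)
  have "germ G E \<alpha> g \<beta> (\<beta> \<cdot> \<zeta>) = unit_germ G E (\<beta> \<cdot> \<zeta>) \<longleftrightarrow>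
      (\<exists>\<nu>. is_prefix E \<nu> (\<beta> \<cdot> \<zeta>) \<and> germ_eq_at G E (\<alpha>, g, \<beta>) (vpath v, v, vpath v) \<nu>)" (is "_ \<longleftrightarrow> ?ex")
    unfolding unit_germ_def \<xi>(2) germ_eq_iff[OF reps] by simp
  also have "\<dots> \<longleftrightarrow> \<alpha> = \<beta> \<and> strongly_fixed G E g \<zeta>"
  proof
    assume ?ex
    then obtain \<beta>' \<delta>' where \<beta>': "\<beta>' \<in> fin_paths E" "\<delta>' \<in> fin_paths E" "composable E \<beta> \<beta>'"
        "composable E (vpath v) \<delta>'" "\<beta> \<cdot> \<beta>' = vpath v \<cdot> \<delta>'"
        "\<alpha> \<cdot> pact G g \<beta>' = vpath v \<cdot> pact G v \<delta>'" "pres G g \<beta>' = pres G v \<delta>'"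
        "is_prefix E (\<beta> \<cdot> \<beta>') (\<beta> \<cdot> \<zeta>)"
      by (auto simp: germ_eq_at_def)
    have \<delta>': "prange E \<delta>' = v" "\<delta>' \<in> path_space E"
      using composableD[OF \<beta>'(4)] by simp_all
    then have eq: "\<delta>' = \<beta> \<cdot> \<beta>'"
      using \<beta>'(5) vpath_pconc by metis
    have act: "\<alpha> \<cdot> pact G g \<beta>' = \<beta> \<cdot> \<beta>'"
      using \<beta>'(6) pact_vertex[OF \<delta>'(2)] vpath_pconc[OF \<delta>'(2)] \<delta>'(1) eq by simp
    have res: "pres G g \<beta>' = psource E \<beta>'"
      using \<beta>'(7) pres_vertex[OF \<beta>'(2)] \<delta>'(1) psource_pconc[OF \<beta>'(3)] eq by simp
    obtain a as b bs u es where lists: "\<alpha> = FPath a as" "\<beta> = FPath b bs" "\<beta>' = FPath u es"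
      using tri(1,2) \<beta>'(1) fin_pathsE by metis
    \<comment> \<open>The action preserves the length of \<open>es\<close>, so equal concatenations
      have equal first and second parts.\<close>
    have "a = b" "as = bs" "act_list G g es = es"
      using act by (simp_all add: lists)
    then have "\<alpha> = \<beta>"
      by (simp add: lists)
    moreover have "u = gsource G g"
      using composableD(3)[OF \<beta>'(3)] tri(5) lists by simp
    then have "fin_strongly_fixed G E g \<beta>'"
      using \<beta>'(1) res tri(4,5) lists \<open>act_list G g es = es\<close> \<open>\<alpha> = \<beta>\<close>
      by (simp add: fin_strongly_fixed_def)
    then have "strongly_fixed G E g \<zeta>"
      using strongly_fixed_mono is_prefix_pconc_cancel[OF \<beta>'(3,1) assms(2) \<beta>'(8)] by blast
    ultimately show "\<alpha> = \<beta> \<and> strongly_fixed G E g \<zeta>" ..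
  next
    assume *: "\<alpha> = \<beta> \<and> strongly_fixed G E g \<zeta>"
    then obtain \<nu> where \<nu>: "is_prefix E \<nu> \<zeta>" "fin_strongly_fixed G E g \<nu>"
      using strongly_fixed_iff composableD(2)[OF assms(2)] by blast
    note sf = fin_strongly_fixedD[OF \<nu>(2)]
    have comp: "composable E \<beta> \<nu>"
      using composable_prefix[OF assms(2) \<nu>(1)] .
    then have \<beta>\<nu>: "\<beta> \<cdot> \<nu> \<in> fin_paths E" "prange E (\<beta> \<cdot> \<nu>) = v" "\<beta> \<cdot> \<nu> \<in> path_space E"
        "psource E (\<beta> \<cdot> \<nu>) = psource E \<nu>"
      using pconc_mem_fin_paths_iff sf(1) prange_pconc pconc_mem_path_space psource_pconc
      by (auto simp: v_def)
    have "germ_eq_at G E (\<alpha>, g, \<beta>) (vpath v, v, vpath v) (\<beta> \<cdot> \<nu>)"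
    proof (rule germ_eq_atI[OF sf(1) \<beta>\<nu>(1) comp])
      show "composable E (vpath v) (\<beta> \<cdot> \<nu>)" "\<beta> \<cdot> \<nu> = vpath v \<cdot> (\<beta> \<cdot> \<nu>)"
        using composable_vpath[OF \<beta>\<nu>(3)] vpath_pconc[OF \<beta>\<nu>(3)] \<beta>\<nu>(2) by simp_all
      show "\<alpha> \<cdot> pact G g \<nu> = vpath v \<cdot> pact G v (\<beta> \<cdot> \<nu>)"
        using pact_vertex[OF \<beta>\<nu>(3)] vpath_pconc[OF \<beta>\<nu>(3)] \<beta>\<nu>(2) * sf(3) by simp
      show "pres G g \<nu> = pres G v (\<beta> \<cdot> \<nu>)"
        using pres_vertex[OF \<beta>\<nu>(1)] \<beta>\<nu> sf(4) by simp
    qed simp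
    then show ?ex
      using is_prefix_pconc_mono[OF comp \<nu>(1)] by blast
  qed
  finally show ?thesis .
qed

section \<open>The topology on germs\<close>

lemma openin_germ_image:
  assumes "(\<alpha>, g, \<beta>) \<in> germ_triples G E" "openin (path_topology E) V" "V \<subseteq> cylinder E \<beta>"
  shows "openin (germ_topology G E) (germ G E \<alpha> g \<beta> ` V)"
  unfolding germ_topology_def by (rule topology_generated_by_Basis) (use assms in blast)

lemma topspace_germ_topology: "topspace (germ_topology G E) = germs G E"
proof
  show "topspace (germ_topology G E) \<subseteq> germs G E"
    unfolding germ_topology_def topology_generated_by_topspace
    by (auto intro!: germ_mem_germs simp: germ_reps_iff subset_iff simp flip: mem_cylinder)
  show "germs G E \<subseteq> topspace (germ_topology G E)"
  proof
    fix c assume "c \<in> germs G E"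
    then obtain \<alpha> g \<beta> \<xi> where c: "(\<alpha>, g, \<beta>, \<xi>) \<in> germ_reps G E" "c = germ G E \<alpha> g \<beta> \<xi>"
      by (rule germsE)
    then have "c \<in> germ G E \<alpha> g \<beta> ` cylinder E \<beta>"
      by (simp add: germ_reps_def)
    moreover have "openin (germ_topology G E) (germ G E \<alpha> g \<beta> ` cylinder E \<beta>)"
      using c(1) by (intro openin_germ_image openin_cylinder) (auto simp: germ_reps_iff germ_triples_def)
    ultimately show "c \<in> topspace (germ_topology G E)"
      using openin_subset by blast
  qed
qed

text \<open>The triple is an arbitrary representative of the germ, so one fixed triple can be used
  for all nearby points.\<close>

lemma germ_topology_nbhd:
  assumes "openin (germ_topology G E) W" "(\<alpha>, g, \<beta>, \<xi>) \<in> germ_reps G E" "germ G E \<alpha> g \<beta> \<xi> \<in> W"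
  obtains V where "openin (path_topology E) V" "\<xi> \<in> V" "V \<subseteq> cylinder E \<beta>" "germ G E \<alpha> g \<beta> ` V \<subseteq> W"
proof -
  have "\<exists>V. openin (path_topology E) V \<and> \<xi> \<in> V \<and> V \<subseteq> cylinder E \<beta> \<and> germ G E \<alpha> g \<beta> ` V \<subseteq> W"
    using assms(1,3) unfolding germ_topology_def openin_topology_generated_by_iff
  proof (induction rule: generate_topology_on.induct)
    case (Int a b)
    then obtain V V' where "openin (path_topology E) V \<and> \<xi> \<in> V \<and> V \<subseteq> cylinder E \<beta> \<and> germ G E \<alpha> g \<beta> ` V \<subseteq> a"
        "openin (path_topology E) V' \<and> \<xi> \<in> V' \<and> V' \<subseteq> cylinder E \<beta> \<and> germ G E \<alpha> g \<beta> ` V' \<subseteq> b"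
      by auto
    then show ?case
      by (intro exI[of _ "V \<inter> V'"]) auto
  next
    case (UN K)
    then obtain k where k: "k \<in> K" "germ G E \<alpha> g \<beta> \<xi> \<in> k"
      by blast
    obtain V where "openin (path_topology E) V \<and> \<xi> \<in> V \<and> V \<subseteq> cylinder E \<beta> \<and> germ G E \<alpha> g \<beta> ` V \<subseteq> k"
      using UN.IH[OF k] ..
    then show ?case
      using k(1) by (intro exI[of _ V]) auto
  next
    case (Basis s)
    then obtain \<gamma> h \<delta> V where s: "s = germ G E \<gamma> h \<delta> ` V" "(\<gamma>, h, \<delta>) \<in> germ_triples G E"
        "openin (path_topology E) V" "V \<subseteq> cylinder E \<delta>"
      by auto
    then obtain \<eta> where \<eta>: "\<eta> \<in> V" "germ G E \<alpha> g \<beta> \<xi> = germ G E \<gamma> h \<delta> \<eta>"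
      using Basis(2) by auto
    have "(\<gamma>, h, \<delta>, \<eta>) \<in> germ_reps G E"
      using s \<eta>(1) by (auto simp: germ_reps_def)
    then obtain \<nu> where \<nu>: "\<xi> = \<eta>" "is_prefix E \<nu> \<xi>" "germ_eq_at G E (\<alpha>, g, \<beta>) (\<gamma>, h, \<delta>) \<nu>"
      using \<eta>(2) germ_eq_iff[OF assms(2)] by blast
    \<comment> \<open>Agreement at \<nu> involves \<xi> only through the prefix \<nu>, so both
      triples define the same germ at every path of V in Z(\<nu>).\<close>
    define U where "U = V \<inter> cylinder E \<nu>"
    have "is_prefix E \<beta> \<nu>"
      using \<nu>(3) is_prefix_pconc by (auto simp: germ_eq_at_def)
    then have U\<beta>: "U \<subseteq> cylinder E \<beta>"
      using is_prefix_trans by (auto simp: U_def mem_cylinder)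
    have "germ G E \<alpha> g \<beta> \<theta> = germ G E \<gamma> h \<delta> \<theta>" if \<theta>: "\<theta> \<in> U" for \<theta>
    proof -
      have "(\<alpha>, g, \<beta>, \<theta>) \<in> germ_reps G E" "(\<gamma>, h, \<delta>, \<theta>) \<in> germ_reps G E"
        using \<theta> U\<beta> s assms(2) by (auto simp: germ_reps_def U_def)
      then show ?thesis
        using germ_eq_iff \<theta> \<nu>(3) by (auto simp: U_def mem_cylinder)
    qed
    then have "germ G E \<alpha> g \<beta> ` U \<subseteq> s"
      by (auto simp: s(1) U_def)
    moreover have "openin (path_topology E) U"
      unfolding U_def using s(3) openin_cylinder is_prefixD(1)[OF \<nu>(2)] by blast
    moreover have "\<xi> \<in> U"
      using \<nu> \<eta>(1) by (simp add: U_def mem_cylinder)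
    ultimately show ?case
      using U\<beta> by blast
  qed simp
  then show ?thesis
    using that by blast
qed

section \<open>The unit space inside the space of germs\<close>

text \<open>On Z(v) all units share one triple, so the inclusion of the units is there one of the
  sections that generate the topology.\<close>

lemma unit_germ_eq_germ:
  assumes "\<xi> \<in> cylinder E (vpath v)"
  shows "unit_germ G E \<xi> = germ G E (vpath v) v (vpath v) \<xi>"
  using is_prefixD(3) assms unfolding mem_cylinder unit_germ_def by fastforce

lemma vertex_triple: "v \<in> verts E \<Longrightarrow> (vpath v, v, vpath v) \<in> germ_triples G E"
  by (simp add: germ_triples_def vertex_unit)

lemma openin_unit_germ_image:
  assumes "openin (path_topology E) V" "V \<subseteq> cylinder E (vpath v)" "v \<in> verts E"
  shows "openin (germ_topology G E) (unit_germ G E ` V)"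
proof -
  have "unit_germ G E ` V = germ G E (vpath v) v (vpath v) ` V"
    using assms(2) unit_germ_eq_germ by (intro image_cong) auto
  then show ?thesis
    using openin_germ_image[OF vertex_triple] assms by simp
qed

lemma unit_germ_nbhd:
  assumes "openin (germ_topology G E) W" "\<xi> \<in> path_space E" "unit_germ G E \<xi> \<in> W"
  obtains V where "openin (path_topology E) V" "\<xi> \<in> V" "unit_germ G E ` V \<subseteq> W"
proof -
  obtain V where V: "openin (path_topology E) V" "\<xi> \<in> V" "V \<subseteq> cylinder E (vpath (prange E \<xi>))"
      "germ G E (vpath (prange E \<xi>)) (prange E \<xi>) (vpath (prange E \<xi>)) ` V \<subseteq> W"
    using germ_topology_nbhd[OF assms(1) unit_germ_rep[OF assms(2)]] assms(3)
    unfolding unit_germ_def by metis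
  then have "unit_germ G E ` V \<subseteq> W"
    using unit_germ_eq_germ by blast
  then show ?thesis
    using V that by blast
qed

lemma germ_source_unit_germ: "\<xi> \<in> path_space E \<Longrightarrow> germ_source E (unit_germ G E \<xi>) = \<xi>"
  unfolding unit_germ_def by (rule germ_source_germ[OF unit_germ_rep])

lemma germ_range_unit_germ:
  assumes "\<xi> \<in> path_space E"
  shows "germ_range G E (unit_germ G E \<xi>) = \<xi>"
  using germ_range_germ[OF _ composable_vpath[OF assms]] unit_germ_rep[OF assms] vpath_pconc[OF assms]
    pact_vertex[OF assms]
  by (simp add: unit_germ_def)

lemma unit_germ_mem_germs: "\<xi> \<in> path_space E \<Longrightarrow> unit_germ G E \<xi> \<in> germs G E"
  unfolding unit_germ_def by (rule germ_mem_germs[OF unit_germ_rep])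

lemma unit_germ_mem_boundary_germs: "\<mu> \<in> boundary E \<Longrightarrow> unit_germ G E \<mu> \<in> boundary_germs G E"
  using boundary_subset_path_space germ_source_unit_germ germ_range_unit_germ unit_germ_mem_germs
  by (auto simp: boundary_germs_def)

lemma inj_on_unit_germ: "inj_on (unit_germ G E) (path_space E)"
  using germ_source_unit_germ by (metis inj_onI)

lemma topspace_boundary_germ_topology: "topspace (boundary_germ_topology G E) = boundary_germs G E"
  by (auto simp: boundary_germ_topology_def topspace_germ_topology boundary_germs_def)

section \<open>Singular decompositions\<close>

lemma mem_inf_sing_decsE:
  assumes "(\<alpha>, g) \<in> inf_sing_decs G E \<mu>"
  obtains \<zeta> where "\<alpha> \<in> fin_paths E" "g \<in> arrows G" "psource E \<alpha> = grange G g" "composable E \<alpha> \<zeta>"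
    "\<mu> = \<alpha> \<cdot> \<zeta>" "\<not> strongly_fixed G E g \<zeta>"
    "\<forall>\<nu>. is_prefix E \<nu> \<zeta> \<longrightarrow> (\<exists>\<kappa>. fin_strongly_fixed G E g \<kappa> \<and> is_prefix E \<nu> \<kappa>)"
proof -
  obtain \<zeta> where \<zeta>: "\<alpha> \<in> fin_paths E" "g \<in> arrows G" "psource E \<alpha> = grange G g" "composable E \<alpha> \<zeta>"
    "\<mu> = \<alpha> \<cdot> \<zeta>" "\<not> strongly_fixed G E g \<zeta>"
    "\<forall>\<nu>\<in>fin_paths E. is_prefix E \<nu> \<zeta> \<longrightarrow> (\<exists>\<eta>. is_prefix E \<nu> \<eta> \<and> strongly_fixed G E g \<eta>)"
    using assms unfolding inf_sing_decs_def by blast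
  have "\<exists>\<kappa>. fin_strongly_fixed G E g \<kappa> \<and> is_prefix E \<nu> \<kappa>" if \<nu>: "is_prefix E \<nu> \<zeta>" for \<nu>
  proof -
    obtain \<eta> where "is_prefix E \<nu> \<eta>" "strongly_fixed G E g \<eta>"
      using \<zeta>(7) is_prefixD(1)[OF \<nu>] \<nu> by blast
    then show ?thesis
      using strongly_fixed_prefix by metis
  qed
  then show ?thesis
    using that[OF \<zeta>(1-6)] by simp
qed

lemma mem_fin_sing_decsE:
  assumes "(\<alpha>, g) \<in> fin_sing_decs G E \<mu>"
  obtains \<zeta> I where "\<alpha> \<in> fin_paths E" "g \<in> arrows G" "psource E \<alpha> = grange G g" "composable E \<alpha> \<zeta>"
    "\<mu> = \<alpha> \<cdot> \<zeta>" "\<not> strongly_fixed G E g \<zeta>" "I \<subseteq> edges_at E (psource E \<mu>)" "infinite I"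
    "\<forall>e\<in>I. \<exists>\<kappa>. fin_strongly_fixed G E g \<kappa> \<and> is_prefix E (\<zeta> \<cdot> epath E e) \<kappa>"
proof -
  obtain \<zeta> I where \<zeta>: "\<alpha> \<in> fin_paths E" "g \<in> arrows G" "psource E \<alpha> = grange G g" "composable E \<alpha> \<zeta>"
    "\<mu> = \<alpha> \<cdot> \<zeta>" "\<not> strongly_fixed G E g \<zeta>" "I \<subseteq> edges_at E (psource E \<mu>)" "infinite I"
    "\<forall>e\<in>I. \<exists>\<eta>. is_prefix E (\<zeta> \<cdot> epath E e) \<eta> \<and> strongly_fixed G E g \<eta>"
    using assms unfolding fin_sing_decs_def by blast
  have "\<exists>\<kappa>. fin_strongly_fixed G E g \<kappa> \<and> is_prefix E (\<zeta> \<cdot> epath E e) \<kappa>" if e: "e \<in> I" for e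
  proof -
    obtain \<eta> where "is_prefix E (\<zeta> \<cdot> epath E e) \<eta>" "strongly_fixed G E g \<eta>"
      using \<zeta>(9) e by blast
    then show ?thesis
      using strongly_fixed_prefix by metis
  qed
  then show ?thesis
    using that[OF \<zeta>(1-8)] by simp
qed

text \<open>Common form of the two definitions. Near \<mu> there is a whole cylinder
  Z(\<alpha>\<kappa>), not merely a point, so that a boundary path can be chosen in it. That g fixes
  \<zeta>, though not strongly, puts the germ into the isotropy at \<mu>.\<close>

lemma mem_sing_decsE:
  assumes "(\<alpha>, g) \<in> sing_decs G E \<mu>" "\<mu> \<in> path_space E"
  obtains \<zeta> where "(\<alpha>, g, \<alpha>) \<in> germ_triples G E" "composable E \<alpha> \<zeta>" "\<mu> = \<alpha> \<cdot> \<zeta>"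
    "\<not> strongly_fixed G E g \<zeta>" "pact G g \<zeta> = \<zeta>" "\<mu> \<in> boundary E"
    "\<forall>V. openin (path_topology E) V \<longrightarrow> \<mu> \<in> V \<longrightarrow>
       (\<exists>\<kappa>. fin_strongly_fixed G E g \<kappa> \<and> composable E \<alpha> \<kappa> \<and> cylinder E (\<alpha> \<cdot> \<kappa>) \<subseteq> V)"
proof (cases "\<mu> \<in> inf_paths E")
  case True
  then have "(\<alpha>, g) \<in> inf_sing_decs G E \<mu>"
    using assms by (simp add: sing_decs_def)
  then obtain \<zeta> where \<zeta>: "\<alpha> \<in> fin_paths E" "g \<in> arrows G" "psource E \<alpha> = grange G g" "composable E \<alpha> \<zeta>"
      "\<mu> = \<alpha> \<cdot> \<zeta>" "\<not> strongly_fixed G E g \<zeta>"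
      and ext': "\<forall>\<nu>. is_prefix E \<nu> \<zeta> \<longrightarrow> (\<exists>\<kappa>. fin_strongly_fixed G E g \<kappa> \<and> is_prefix E \<nu> \<kappa>)"
    by (rule mem_inf_sing_decsE)
  note ext = ext'[rule_format]
  have inf: "\<zeta> \<in> inf_paths E"
    using pconc_mem_inf_paths_iff[OF \<zeta>(4)] True \<zeta>(5) by simp
  have near: "\<exists>\<kappa>. fin_strongly_fixed G E g \<kappa> \<and> composable E \<alpha> \<kappa> \<and> cylinder E (\<alpha> \<cdot> \<kappa>) \<subseteq> V"
    if V: "openin (path_topology E) V" "\<mu> \<in> V" for V
  proof -
    obtain N where N: "\<And>\<nu>. is_prefix E \<nu> \<mu> \<Longrightarrow> N \<le> plength \<nu> \<Longrightarrow> cylinder E \<nu> \<subseteq> V"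
      using inf_path_nbhd[OF V True] by metis
    obtain \<nu> where \<nu>: "is_prefix E \<nu> \<zeta>" "plength \<nu> = N"
      using inf_paths_prefix_plength[OF inf] by metis
    have comp: "composable E \<alpha> \<nu>"
      using composable_prefix[OF \<zeta>(4) \<nu>(1)] .
    have "cylinder E (\<alpha> \<cdot> \<nu>) \<subseteq> V"
      using N[of "\<alpha> \<cdot> \<nu>"] is_prefix_pconc_mono[OF comp \<nu>(1)] \<zeta>(5) \<nu>(2)
        plength_pconc[OF comp is_prefixD(1)[OF \<nu>(1)]] by simp
    moreover obtain \<kappa> where \<kappa>: "fin_strongly_fixed G E g \<kappa>" "is_prefix E \<nu> \<kappa>"
      using ext[OF \<nu>(1)] by blast
    moreover have "cylinder E (\<alpha> \<cdot> \<kappa>) \<subseteq> cylinder E (\<alpha> \<cdot> \<nu>)"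
      using is_prefix_trans[OF is_prefix_pconc_mono[OF comp \<kappa>(2)]] by (auto simp: mem_cylinder)
    ultimately show ?thesis
      using composable_extension[OF comp \<kappa>(2)] by blast
  qed
  \<comment> \<open>A singular decomposition prescribes only r(g). The source of g is the range of a
    strongly fixed extension of the prefix of length 0 of \<zeta>, hence the range of
    \<zeta>.\<close>
  have "gsource G g = prange E \<zeta>"
    using ext[OF is_prefix_vpath[OF composableD(2)[OF \<zeta>(4)]]] is_prefixD(3) fin_strongly_fixedD(2)
    by fastforce
  then have "(\<alpha>, g, \<alpha>) \<in> germ_triples G E"
    using \<zeta> composableD(3)[OF \<zeta>(4)] by (simp add: germ_triples_def)
  moreover have "pact G g \<zeta> = \<zeta>"
    using pact_fixed_inf_path[OF inf] ext pact_fixed_prefix by blast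
  moreover have "\<mu> \<in> boundary E"
    using True by (simp add: boundary_def)
  ultimately show ?thesis
    using that[OF _ \<zeta>(4-6)] near by simp
next
  case False
  then have "\<mu> \<in> fin_paths E" and "(\<alpha>, g) \<in> fin_sing_decs G E \<mu>"
    using assms by (auto simp: sing_decs_def path_space_def)
  note \<mu> = this(1)
  from \<open>(\<alpha>, g) \<in> fin_sing_decs G E \<mu>\<close> obtain \<zeta> I where \<zeta>: "\<alpha> \<in> fin_paths E" "g \<in> arrows G" "psource E \<alpha> = grange G g" "composable E \<alpha> \<zeta>"
      "\<mu> = \<alpha> \<cdot> \<zeta>" "\<not> strongly_fixed G E g \<zeta>" and I: "I \<subseteq> edges_at E (psource E \<mu>)" "infinite I"
      and ext': "\<forall>e\<in>I. \<exists>\<kappa>. fin_strongly_fixed G E g \<kappa> \<and> is_prefix E (\<zeta> \<cdot> epath E e) \<kappa>"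
    by (rule mem_fin_sing_decsE)
  note ext = ext'[rule_format]
  have fin: "\<zeta> \<in> fin_paths E" "psource E \<mu> = psource E \<zeta>"
    using pconc_mem_fin_paths_iff[OF \<zeta>(4)] psource_pconc[OF \<zeta>(4)] \<mu> \<zeta>(5) by simp_all
  have \<zeta>e: "is_prefix E \<zeta> \<kappa>" if "e \<in> I" "is_prefix E (\<zeta> \<cdot> epath E e) \<kappa>" for e \<kappa>
    using is_prefix_trans[OF is_prefix_pconc[OF composable_epath(1)] that(2)] fin I(1) that(1) by auto
  have near: "\<exists>\<kappa>. fin_strongly_fixed G E g \<kappa> \<and> composable E \<alpha> \<kappa> \<and> cylinder E (\<alpha> \<cdot> \<kappa>) \<subseteq> V"
    if V: "openin (path_topology E) V" "\<mu> \<in> V" for V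
  proof -
    obtain F where F: "finite F" "F \<subseteq> edges_at E (psource E \<mu>)"
        "cylinder E \<mu> - (\<Union>e\<in>F. cylinder E (\<mu> \<cdot> epath E e)) \<subseteq> V"
      using fin_path_nbhd[OF V \<mu>] by metis
    \<comment> \<open>The infinite set I is not exhausted by the finitely many removed edges, and
      the cylinder of the remaining edge avoids theirs.\<close>
    obtain e where e: "e \<in> I" "e \<notin> F"
      using I(2) F(1) by (meson finite_subset subsetI)
    then obtain \<kappa> where \<kappa>: "fin_strongly_fixed G E g \<kappa>" "is_prefix E (\<zeta> \<cdot> epath E e) \<kappa>"
      using ext by blast
    have comp: "composable E \<alpha> (\<zeta> \<cdot> epath E e)"
      using composable_pconc_right[OF \<zeta>(4) composable_epath(1)] fin I(1) e(1) by auto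
    have "\<alpha> \<cdot> \<zeta> \<cdot> epath E e = \<mu> \<cdot> epath E e"
      using pconc_assoc[OF \<zeta>(1) fin(1)] \<zeta>(5) by simp
    then have \<mu>e: "is_prefix E (\<mu> \<cdot> epath E e) (\<alpha> \<cdot> \<kappa>)"
      using is_prefix_pconc_mono[OF comp \<kappa>(2)] by simp
    have "cylinder E (\<alpha> \<cdot> \<kappa>) \<subseteq> cylinder E \<mu> - (\<Union>e\<in>F. cylinder E (\<mu> \<cdot> epath E e))"
    proof
      fix \<theta> assume "\<theta> \<in> cylinder E (\<alpha> \<cdot> \<kappa>)"
      then have \<theta>: "is_prefix E (\<mu> \<cdot> epath E e) \<theta>"
        using is_prefix_trans[OF \<mu>e] by (simp add: mem_cylinder)
      then have "is_prefix E \<mu> \<theta>"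
        using is_prefix_trans[OF is_prefix_pconc[OF composable_epath(1)]] \<mu> I(1) e(1) by blast
      moreover have "\<not> is_prefix E (\<mu> \<cdot> epath E f) \<theta>" if "f \<in> F" for f
        using is_prefix_epath_unique[OF \<mu> \<theta>, of f] that e(2) by blast
      ultimately show "\<theta> \<in> cylinder E \<mu> - (\<Union>e\<in>F. cylinder E (\<mu> \<cdot> epath E e))"
        by (simp add: mem_cylinder)
    qed
    moreover have "composable E \<alpha> \<kappa>"
      using composable_extension[OF comp \<kappa>(2)] .
    ultimately show ?thesis
      using \<kappa>(1) F(3) by blast
  qed
  obtain e where "e \<in> I"
    using I(2) by (metis finite.emptyI equals0I)
  then obtain \<kappa> where \<kappa>: "fin_strongly_fixed G E g \<kappa>" "is_prefix E \<zeta> \<kappa>"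
    using ext \<zeta>e by blast
  have "gsource G g = prange E \<zeta>"
    using is_prefixD(3)[OF \<kappa>(2)] fin_strongly_fixedD(2)[OF \<kappa>(1)] by simp
  then have "(\<alpha>, g, \<alpha>) \<in> germ_triples G E"
    using \<zeta> composableD(3)[OF \<zeta>(4)] by (simp add: germ_triples_def)
  moreover have "pact G g \<zeta> = \<zeta>"
    using pact_fixed_prefix[OF \<kappa>] .
  \<comment> \<open>An infinite set of edges with range s(\<mu>) makes s(\<mu>) singular. This is
    why no non-Hausdorff units lie outside the boundary.\<close>
  moreover have "\<mu> \<in> boundary E"
    using \<mu> I finite_subset by (auto simp: boundary_def singular_def)
  ultimately show ?thesis
    using that[OF _ \<zeta>(4-6)] near by simp
qed

text \<open>The approximation is tested on special neighbourhoods: the cylinders Z(\<alpha>\<nu>)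
  for an infinite path, and for a finite one its cylinder with finitely many Z(\<alpha>\<zeta>e)
  removed.\<close>

lemma mem_sing_decsI:
  assumes "(\<alpha>, g, \<alpha>) \<in> germ_triples G E" "composable E \<alpha> \<zeta>" "\<not> strongly_fixed G E g \<zeta>"
    and near: "\<And>V. openin (path_topology E) V \<Longrightarrow> \<alpha> \<cdot> \<zeta> \<in> V \<Longrightarrow>
      \<exists>\<eta>. composable E \<alpha> \<eta> \<and> \<alpha> \<cdot> \<eta> \<in> V \<and> strongly_fixed G E g \<eta>"
  shows "(\<alpha>, g) \<in> sing_decs G E (\<alpha> \<cdot> \<zeta>)"
proof (cases "\<alpha> \<cdot> \<zeta> \<in> inf_paths E")
  case True
  note tri = germ_triplesD[OF assms(1)]
  have "\<exists>\<eta>. is_prefix E \<nu> \<eta> \<and> strongly_fixed G E g \<eta>" if \<nu>: "is_prefix E \<nu> \<zeta>" for \<nu>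
  proof -
    have fin: "\<nu> \<in> fin_paths E"
      using \<nu> by (rule is_prefixD)
    have comp: "composable E \<alpha> \<nu>"
      using composable_prefix[OF assms(2) \<nu>] .
    have "openin (path_topology E) (cylinder E (\<alpha> \<cdot> \<nu>))" "\<alpha> \<cdot> \<zeta> \<in> cylinder E (\<alpha> \<cdot> \<nu>)"
      using openin_cylinder pconc_mem_fin_paths_iff[OF comp] fin is_prefix_pconc_mono[OF comp \<nu>]
      by (simp_all add: mem_cylinder)
    then obtain \<eta> where "composable E \<alpha> \<eta>" "is_prefix E (\<alpha> \<cdot> \<nu>) (\<alpha> \<cdot> \<eta>)" "strongly_fixed G E g \<eta>"
      using near mem_cylinder by blast
    then show ?thesis
      using is_prefix_pconc_cancel[OF comp fin] by blast
  qed
  then show ?thesis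
    using True tri assms(2,3) unfolding sing_decs_def inf_sing_decs_def by auto
next
  case False
  note tri = germ_triplesD[OF assms(1)]
  have \<mu>: "\<alpha> \<cdot> \<zeta> \<in> fin_paths E"
    using False pconc_mem_path_space[OF assms(2)] by (auto simp: path_space_def)
  have \<zeta>: "\<zeta> \<in> fin_paths E" "psource E (\<alpha> \<cdot> \<zeta>) = psource E \<zeta>"
    using pconc_mem_fin_paths_iff[OF assms(2)] \<mu> psource_pconc[OF assms(2)] by simp_all
  \<comment> \<open>The largest candidate. Were it finite, removing the cylinders of its edges would
    still leave a neighbourhood of \<alpha>\<zeta>.\<close>
  define I where "I = {e \<in> edges_at E (psource E (\<alpha> \<cdot> \<zeta>)).
    \<exists>\<eta>. is_prefix E (\<zeta> \<cdot> epath E e) \<eta> \<and> strongly_fixed G E g \<eta>}"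
  have "infinite I"
  proof
    assume "finite I"
    define V where "V = cylinder E (\<alpha> \<cdot> \<zeta>) - (\<Union>e\<in>I. cylinder E ((\<alpha> \<cdot> \<zeta>) \<cdot> epath E e))"
    have "openin (path_topology E) V"
      unfolding V_def using \<open>finite I\<close> by (intro openin_cylinder_diff_edges[OF \<mu>]) (auto simp: I_def)
    moreover have "\<not> is_prefix E ((\<alpha> \<cdot> \<zeta>) \<cdot> epath E e) (\<alpha> \<cdot> \<zeta>)" for e
      using is_prefix_length[OF _ \<mu>, of "(\<alpha> \<cdot> \<zeta>) \<cdot> epath E e"] \<mu> by (auto elim!: fin_pathsE)
    then have "\<alpha> \<cdot> \<zeta> \<in> V"
      using is_prefix_refl[OF \<mu>] by (simp add: V_def mem_cylinder)
    ultimately obtain \<eta> where \<eta>: "composable E \<alpha> \<eta>" "\<alpha> \<cdot> \<eta> \<in> V" "strongly_fixed G E g \<eta>"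
      using near by blast
    have "is_prefix E \<zeta> \<eta>"
      using \<eta>(1,2) is_prefix_pconc_cancel[OF assms(2) \<zeta>(1)] by (simp add: V_def mem_cylinder)
    then obtain \<rho> where \<rho>: "composable E \<zeta> \<rho>" "\<eta> = \<zeta> \<cdot> \<rho>"
      by (rule is_prefixE)
    \<comment> \<open>\<eta> is strongly fixed and \<zeta> is not, so \<eta> properly extends
      \<zeta>. Its next edge belongs to I, although \<alpha>\<eta> was chosen outside the cylinders
      of the edges in I.\<close>
    have "\<rho> \<noteq> vpath (psource E \<zeta>)"
      using \<rho>(2) \<eta>(3) assms(3) pconc_vpath[OF \<zeta>(1)] by auto
    then obtain e where e: "e \<in> edges_at E (psource E \<zeta>)" "is_prefix E (epath E e) \<rho>"
      using epath_split[OF \<rho>(1)] by metis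
    have comp: "composable E \<zeta> (epath E e)"
      using composable_epath[OF \<zeta>(1) e(1)] by simp
    have pre: "is_prefix E (\<zeta> \<cdot> epath E e) \<eta>"
      using is_prefix_pconc_mono[OF comp e(2)] \<rho>(2) by simp
    then have "e \<in> I"
      using e(1) \<eta>(3) \<zeta>(2) by (auto simp: I_def)
    moreover have "is_prefix E ((\<alpha> \<cdot> \<zeta>) \<cdot> epath E e) (\<alpha> \<cdot> \<eta>)"
      using is_prefix_pconc_mono[OF composable_pconc_right[OF assms(2) comp] pre]
        pconc_assoc[OF tri(1) \<zeta>(1)] by simp
    ultimately show False
      using \<eta>(2) by (auto simp: V_def mem_cylinder)
  qed
  moreover have "I \<subseteq> edges_at E (psource E (\<alpha> \<cdot> \<zeta>))"
      "\<forall>e\<in>I. \<exists>\<eta>. is_prefix E (\<zeta> \<cdot> epath E e) \<eta> \<and> strongly_fixed G E g \<eta>"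
    by (auto simp: I_def)
  ultimately have "(\<alpha>, g) \<in> fin_sing_decs G E (\<alpha> \<cdot> \<zeta>)"
    using tri(1,3,4) assms(2,3) unfolding fin_sing_decs_def by auto
  then show ?thesis
    using False by (simp add: sing_decs_def)
qed

lemma sing_dec_germ:
  assumes "(\<alpha>, g) \<in> sing_decs G E \<mu>" "\<mu> \<in> path_space E"
  shows "(\<alpha>, g, \<alpha>, \<mu>) \<in> germ_reps G E" "germ G E \<alpha> g \<alpha> \<mu> \<noteq> unit_germ G E \<mu>" "\<mu> \<in> boundary E"
    "germ_range G E (germ G E \<alpha> g \<alpha> \<mu>) = \<mu>"
    "\<And>V. openin (path_topology E) V \<Longrightarrow> \<mu> \<in> V \<Longrightarrow>
       \<exists>\<xi>\<in>V \<inter> boundary E. germ G E \<alpha> g \<alpha> \<xi> = unit_germ G E \<xi>"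
proof -
  obtain \<zeta> where \<zeta>: "(\<alpha>, g, \<alpha>) \<in> germ_triples G E" "composable E \<alpha> \<zeta>" "\<mu> = \<alpha> \<cdot> \<zeta>"
    "\<not> strongly_fixed G E g \<zeta>" "pact G g \<zeta> = \<zeta>" "\<mu> \<in> boundary E"
    and near: "\<forall>V. openin (path_topology E) V \<longrightarrow> \<mu> \<in> V \<longrightarrow>
       (\<exists>\<kappa>. fin_strongly_fixed G E g \<kappa> \<and> composable E \<alpha> \<kappa> \<and> cylinder E (\<alpha> \<cdot> \<kappa>) \<subseteq> V)"
    using assms by (rule mem_sing_decsE)
  show rep: "(\<alpha>, g, \<alpha>, \<mu>) \<in> germ_reps G E"
    using \<zeta>(1-3) is_prefix_pconc by (simp add: germ_reps_iff)
  show "germ G E \<alpha> g \<alpha> \<mu> \<noteq> unit_germ G E \<mu>"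
    using germ_eq_unit_germ_iff[OF \<zeta>(1,2)] \<zeta>(3,4) by simp
  show "\<mu> \<in> boundary E"
    by fact
  show "germ_range G E (germ G E \<alpha> g \<alpha> \<mu>) = \<mu>"
    using germ_range_germ[OF _ \<zeta>(2)] rep \<zeta>(3,5) by simp
  fix V assume "openin (path_topology E) V" "\<mu> \<in> V"
  then obtain \<kappa> where \<kappa>: "fin_strongly_fixed G E g \<kappa>" "composable E \<alpha> \<kappa>" "cylinder E (\<alpha> \<cdot> \<kappa>) \<subseteq> V"
    using near by blast
  have "\<alpha> \<cdot> \<kappa> \<in> fin_paths E"
    using fin_strongly_fixedD(1)[OF \<kappa>(1)] pconc_mem_fin_paths_iff[OF \<kappa>(2)] by simp
  then obtain \<xi> where \<xi>: "\<xi> \<in> boundary E" "is_prefix E (\<alpha> \<cdot> \<kappa>) \<xi>"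
    by (rule boundary_extension)
  then obtain \<eta> where \<eta>: "composable E \<alpha> \<eta>" "\<xi> = \<alpha> \<cdot> \<eta>"
    using is_prefix_trans[OF is_prefix_pconc[OF \<kappa>(2)]] is_prefixE by metis
  then have "is_prefix E \<kappa> \<eta>"
    using is_prefix_pconc_cancel[OF \<kappa>(2) fin_strongly_fixedD(1)[OF \<kappa>(1)] \<eta>(1)] \<xi>(2) by simp
  then have "germ G E \<alpha> g \<alpha> \<xi> = unit_germ G E \<xi>"
    using germ_eq_unit_germ_iff[OF \<zeta>(1) \<eta>(1)] \<eta>(2) strongly_fixed_mono[OF \<kappa>(1)] by simp
  then show "\<exists>\<xi>\<in>V \<inter> boundary E. germ G E \<alpha> g \<alpha> \<xi> = unit_germ G E \<xi>"
    using \<xi> \<kappa>(3) by (auto simp: mem_cylinder subset_iff)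
qed

text \<open>Shared by the Hausdorff and the closure argument. A single unit among the germs of the
  triple forces \<alpha> = \<beta>; that there are units over every neighbourhood gives the strongly
  fixed paths. The sets V lie in Z(\<beta>) because the triple has germs only there.\<close>

lemma sing_dec_if_limit_of_units:
  assumes "(\<alpha>, g, \<beta>, \<mu>) \<in> germ_reps G E" "germ G E \<alpha> g \<beta> \<mu> \<noteq> unit_germ G E \<mu>"
    and near: "\<And>V. openin (path_topology E) V \<Longrightarrow> \<mu> \<in> V \<Longrightarrow> V \<subseteq> cylinder E \<beta> \<Longrightarrow>
      \<exists>\<xi>\<in>V. germ G E \<alpha> g \<beta> \<xi> = unit_germ G E \<xi>"
  shows "\<alpha> = \<beta> \<and> (\<alpha>, g) \<in> sing_decs G E \<mu>"
proof -
  have tri: "(\<alpha>, g, \<beta>) \<in> germ_triples G E"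
    using assms(1) by (simp add: germ_reps_iff)
  have op: "openin (path_topology E) (cylinder E \<beta>)"
    using openin_cylinder germ_triplesD(2)[OF tri] by simp
  obtain \<zeta> where \<zeta>: "composable E \<beta> \<zeta>" "\<mu> = \<beta> \<cdot> \<zeta>"
    using assms(1) is_prefixE by (metis germ_reps_iff)
  have fixed: "\<exists>\<eta>. composable E \<beta> \<eta> \<and> \<beta> \<cdot> \<eta> \<in> V \<and> \<alpha> = \<beta> \<and> strongly_fixed G E g \<eta>"
    if V: "openin (path_topology E) V" "\<mu> \<in> V" for V
  proof -
    have "openin (path_topology E) (V \<inter> cylinder E \<beta>)" "\<mu> \<in> V \<inter> cylinder E \<beta>"
      using V op assms(1) by (auto simp: germ_reps_def)
    then obtain \<xi> where "\<xi> \<in> V" "\<xi> \<in> cylinder E \<beta>" "germ G E \<alpha> g \<beta> \<xi> = unit_germ G E \<xi>"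
      using near[of "V \<inter> cylinder E \<beta>"] by blast
    moreover from this obtain \<eta> where "composable E \<beta> \<eta>" "\<xi> = \<beta> \<cdot> \<eta>"
      unfolding mem_cylinder by (elim is_prefixE)
    ultimately show ?thesis
      using germ_eq_unit_germ_iff[OF tri] by blast
  qed
  have "\<mu> \<in> cylinder E \<beta>"
    using assms(1) by (simp add: germ_reps_def)
  then have "\<alpha> = \<beta>"
    using fixed[OF op] by blast
  moreover have "(\<beta>, g) \<in> sing_decs G E (\<beta> \<cdot> \<zeta>)"
  proof (rule mem_sing_decsI)
    show "(\<beta>, g, \<beta>) \<in> germ_triples G E"
      using tri \<open>\<alpha> = \<beta>\<close> by simp
    show "\<not> strongly_fixed G E g \<zeta>"
      using germ_eq_unit_germ_iff[OF tri \<zeta>(1)] assms(2) \<zeta>(2) \<open>\<alpha> = \<beta>\<close> by simp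
  qed (use \<zeta> fixed in auto)
  ultimately show ?thesis
    using \<zeta>(2) by simp
qed

section \<open>Points that are not Hausdorff\<close>

lemma sing_decs_if_not_hausdorff:
  assumes "\<mu> \<in> path_space E" "unit_germ G E \<mu> \<notin> hausdorff_points (germ_topology G E)"
  shows "sing_decs G E \<mu> \<noteq> {}"
proof -
  have "unit_germ G E \<mu> \<in> topspace (germ_topology G E)"
    using unit_germ_mem_germs[OF assms(1)] topspace_germ_topology by simp
  then obtain c where c: "c \<in> germs G E" "c \<noteq> unit_germ G E \<mu>"
    and inseparable: "\<not> (\<exists>U V. openin (germ_topology G E) U \<and> openin (germ_topology G E) V \<and>
      unit_germ G E \<mu> \<in> U \<and> c \<in> V \<and> disjnt U V)"
    using assms(2) unfolding hausdorff_points_def topspace_germ_topology by auto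
  obtain \<alpha> g \<beta> \<eta> where rep: "(\<alpha>, g, \<beta>, \<eta>) \<in> germ_reps G E" "c = germ G E \<alpha> g \<beta> \<eta>"
    using c(1) by (rule germsE)
  then have tri: "(\<alpha>, g, \<beta>) \<in> germ_triples G E" and pre: "is_prefix E \<beta> \<eta>"
    by (simp_all add: germ_reps_iff)
  let ?v = "prange E \<mu>"
  have v: "?v \<in> verts E" "openin (path_topology E) (cylinder E (vpath ?v))" "\<mu> \<in> cylinder E (vpath ?v)"
    using path_space_prange[OF assms(1)] openin_cylinder is_prefix_vpath[OF assms(1)]
    by (simp_all add: mem_cylinder)
  have \<beta>: "openin (path_topology E) (cylinder E \<beta>)" "\<eta> \<in> cylinder E \<beta>"
    using openin_cylinder germ_triplesD(2)[OF tri] pre by (simp_all add: mem_cylinder)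
  \<comment> \<open>Two inseparable germs have intersecting sections. The source of a common germ
    shows that it lies over a single point of both U and V.\<close>
  have meet: "\<exists>\<xi>\<in>U \<inter> V. germ G E \<alpha> g \<beta> \<xi> = unit_germ G E \<xi>"
    if U: "openin (path_topology E) U" "\<mu> \<in> U" and V: "openin (path_topology E) V" "\<eta> \<in> V" for U V
  proof -
    let ?U = "U \<inter> cylinder E (vpath ?v)" and ?V = "V \<inter> cylinder E \<beta>"
    have op: "openin (path_topology E) ?U" "openin (path_topology E) ?V"
      using U V v(2) \<beta>(1) by blast+
    have "openin (germ_topology G E) (unit_germ G E ` ?U)"
      using openin_unit_germ_image[OF op(1) _ v(1)] by blast
    moreover have "openin (germ_topology G E) (germ G E \<alpha> g \<beta> ` ?V)"
      using openin_germ_image[OF tri op(2)] by blast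
    moreover have "unit_germ G E \<mu> \<in> unit_germ G E ` ?U" "c \<in> germ G E \<alpha> g \<beta> ` ?V"
      using U(2) V(2) v(3) \<beta>(2) rep(2) by blast+
    ultimately have "\<not> disjnt (unit_germ G E ` ?U) (germ G E \<alpha> g \<beta> ` ?V)"
      using inseparable by blast
    then obtain d where d: "d \<in> unit_germ G E ` ?U" "d \<in> germ G E \<alpha> g \<beta> ` ?V"
      unfolding disjnt_iff by blast
    then obtain \<xi> \<theta> where \<xi>: "\<xi> \<in> ?U" "\<theta> \<in> ?V" "unit_germ G E \<xi> = germ G E \<alpha> g \<beta> \<theta>"
      by blast
    then have "(\<alpha>, g, \<beta>, \<theta>) \<in> germ_reps G E" "\<xi> \<in> path_space E"
      using tri openin_path_topology_subset[OF U(1)] by (auto simp: germ_reps_def)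
    then have "\<xi> = \<theta>"
      using germ_source_germ germ_source_unit_germ \<xi>(3) by metis
    then show ?thesis
      using \<xi> by auto
  qed
  have "\<eta> = \<mu>"
  proof (rule ccontr)
    assume "\<eta> \<noteq> \<mu>"
    then obtain U V where "openin (path_topology E) U" "openin (path_topology E) V" "\<eta> \<in> U" "\<mu> \<in> V"
        "U \<inter> V = {}"
      using path_topology_separation is_prefixD(2)[OF pre] assms(1) by metis
    then show False
      using meet by blast
  qed
  then have "(\<alpha>, g) \<in> sing_decs G E \<mu>"
    using sing_dec_if_limit_of_units[of \<alpha> g \<beta> \<mu>] rep c(2) meet by blast
  then show ?thesis
    by blast
qed

lemma sing_dec_germ_mem_boundary_germs:
  assumes "(\<alpha>, g) \<in> sing_decs G E \<mu>" "\<mu> \<in> path_space E"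
  shows "germ G E \<alpha> g \<alpha> \<mu> \<in> boundary_germs G E" "germ_source E (germ G E \<alpha> g \<alpha> \<mu>) = \<mu>"
  using sing_dec_germ[OF assms] germ_source_germ germ_mem_germs by (auto simp: boundary_germs_def)

text \<open>The common germ is a unit over the boundary, so the conclusion survives restriction to
  the boundary. With U the whole space it also shows that the germ is a limit of such units.\<close>

lemma sing_dec_germ_inseparable:
  assumes "(\<alpha>, g) \<in> sing_decs G E \<mu>" "\<mu> \<in> path_space E"
    and "openin (germ_topology G E) U" "unit_germ G E \<mu> \<in> U"
    and "openin (germ_topology G E) V" "germ G E \<alpha> g \<alpha> \<mu> \<in> V"
  obtains \<xi> where "\<xi> \<in> boundary E" "unit_germ G E \<xi> \<in> U" "unit_germ G E \<xi> \<in> V"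
proof -
  obtain U' where U': "openin (path_topology E) U'" "\<mu> \<in> U'" "unit_germ G E ` U' \<subseteq> U"
    using unit_germ_nbhd[OF assms(3,2,4)] .
  obtain V' where V': "openin (path_topology E) V'" "\<mu> \<in> V'" "germ G E \<alpha> g \<alpha> ` V' \<subseteq> V"
    using germ_topology_nbhd[OF assms(5) sing_dec_germ(1)[OF assms(1,2)] assms(6)] by metis
  have "openin (path_topology E) (U' \<inter> V')" "\<mu> \<in> U' \<inter> V'"
    using U' V' by auto
  then obtain \<xi> where "\<xi> \<in> U' \<inter> V' \<inter> boundary E" "germ G E \<alpha> g \<alpha> \<xi> = unit_germ G E \<xi>"
    using sing_dec_germ(5)[OF assms(1,2)] by blast
  then show ?thesis
    using that[of \<xi>] U'(3) V'(3) by (metis Int_iff image_subset_iff)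
qed

lemma not_hausdorff_if_sing_dec:
  assumes "(\<alpha>, g) \<in> sing_decs G E \<mu>" "\<mu> \<in> path_space E"
  shows "unit_germ G E \<mu> \<notin> hausdorff_points (boundary_germ_topology G E)"
proof
  let ?c = "germ G E \<alpha> g \<alpha> \<mu>"
  assume "unit_germ G E \<mu> \<in> hausdorff_points (boundary_germ_topology G E)"
  then obtain U V where "openin (boundary_germ_topology G E) U" "openin (boundary_germ_topology G E) V"
      and mem: "unit_germ G E \<mu> \<in> U" "?c \<in> V" and "disjnt U V"
    using sing_dec_germ_mem_boundary_germs(1)[OF assms] sing_dec_germ(2)[OF assms]
    unfolding hausdorff_points_def topspace_boundary_germ_topology by blast
  then obtain U' V' where UV: "openin (germ_topology G E) U'" "U = U' \<inter> boundary_germs G E"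
      "openin (germ_topology G E) V'" "V = V' \<inter> boundary_germs G E"
    by (auto simp: boundary_germ_topology_def openin_subtopology)
  then obtain \<xi> where "\<xi> \<in> boundary E" "unit_germ G E \<xi> \<in> U'" "unit_germ G E \<xi> \<in> V'"
    using sing_dec_germ_inseparable[OF assms UV(1) _ UV(3)] mem by blast
  then show False
    using UV unit_germ_mem_boundary_germs \<open>disjnt U V\<close> by (auto simp: disjnt_iff)
qed

end

text \<open>Traces of separating sets separate. In general a subspace may have further Hausdorff
  points, so this gives only one half of the comparison of the two groupoids.\<close>

lemma hausdorff_points_subtopology:
  "hausdorff_points T \<inter> S \<subseteq> hausdorff_points (subtopology T S)"
proof
  fix x assume x: "x \<in> hausdorff_points T \<inter> S"
  have "\<exists>U V. openin (subtopology T S) U \<and> openin (subtopology T S) V \<and> x \<in> U \<and> y \<in> V \<and> disjnt U V"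
    if y: "y \<in> topspace T" "y \<in> S" "y \<noteq> x" for y
  proof -
    obtain U V where "openin T U" "openin T V" "x \<in> U" "y \<in> V" "disjnt U V"
      using x y unfolding hausdorff_points_def by blast
    then show ?thesis
      using x y by (intro exI[of _ "U \<inter> S"] exI[of _ "V \<inter> S"])
        (auto simp: openin_subtopology_Int disjnt_iff)
  qed
  then show "x \<in> hausdorff_points (subtopology T S)"
    using x unfolding hausdorff_points_def by (auto simp: topspace_subtopology)
qed

context self_similar_action
begin

text \<open>The implications form a cycle: a unit not Hausdorff in the restriction is not Hausdorff
  among all germs, hence its path has a singular decomposition, whose germ is an inseparable partner
  inside the restriction.\<close>

lemma not_hausdorff_iff_sing_decs:
  assumes "\<mu> \<in> path_space E"
  shows "unit_germ G E \<mu> \<notin> hausdorff_points (germ_topology G E) \<longleftrightarrow> sing_decs G E \<mu> \<noteq> {}"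
    and "\<mu> \<in> boundary E \<and> unit_germ G E \<mu> \<notin> hausdorff_points (boundary_germ_topology G E) \<longleftrightarrow>
      sing_decs G E \<mu> \<noteq> {}"
proof -
  have 1: "unit_germ G E \<mu> \<notin> hausdorff_points (germ_topology G E)"
    if "\<mu> \<in> boundary E" "unit_germ G E \<mu> \<notin> hausdorff_points (boundary_germ_topology G E)"
    using that(2) unit_germ_mem_boundary_germs[OF that(1)]
      subsetD[OF hausdorff_points_subtopology[of "germ_topology G E" "boundary_germs G E"]]
    unfolding boundary_germ_topology_def by auto
  have 2: "\<mu> \<in> boundary E \<and> unit_germ G E \<mu> \<notin> hausdorff_points (boundary_germ_topology G E)"
    if ne: "sing_decs G E \<mu> \<noteq> {}"
  proof -
    obtain \<alpha> g where "(\<alpha>, g) \<in> sing_decs G E \<mu>"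
      using ne by auto
    then show ?thesis
      using not_hausdorff_if_sing_dec sing_dec_germ(3) assms by blast
  qed
  show "unit_germ G E \<mu> \<notin> hausdorff_points (germ_topology G E) \<longleftrightarrow> sing_decs G E \<mu> \<noteq> {}"
    using 1 2 sing_decs_if_not_hausdorff[OF assms] by blast
  show "\<mu> \<in> boundary E \<and> unit_germ G E \<mu> \<notin> hausdorff_points (boundary_germ_topology G E) \<longleftrightarrow>
      sing_decs G E \<mu> \<noteq> {}"
    using 1 2 sing_decs_if_not_hausdorff[OF assms] by blast
qed

section \<open>The isotropy at a point in the closure of the units\<close>

lemma X_bar_eq:
  assumes "\<mu> \<in> boundary E"
  shows "X_bar G E \<mu> = {unit_germ G E \<mu>} \<union> {germ G E \<alpha> g \<alpha> \<mu> | \<alpha> g. (\<alpha>, g) \<in> sing_decs G E \<mu>}"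
proof -
  have \<mu>: "\<mu> \<in> path_space E"
    using assms boundary_subset_path_space by blast
  \<comment> \<open>The units over the boundary are boundary germs, so closure in the restriction is
    the trace of closure among all germs, and open sets of the larger space can be used.\<close>
  have closure: "c \<in> boundary_germ_topology G E closure_of (unit_germ G E ` boundary E) \<longleftrightarrow>
      c \<in> boundary_germs G E \<and>
      (\<forall>W. openin (germ_topology G E) W \<longrightarrow> c \<in> W \<longrightarrow> (\<exists>\<xi>\<in>boundary E. unit_germ G E \<xi> \<in> W))" for c
  proof -
    have "unit_germ G E ` boundary E \<subseteq> boundary_germs G E"
      using unit_germ_mem_boundary_germs by blast
    then have "boundary_germ_topology G E closure_of (unit_germ G E ` boundary E) =
        boundary_germs G E \<inter> germ_topology G E closure_of (unit_germ G E ` boundary E)"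
      by (simp add: boundary_germ_topology_def closure_of_subtopology Int_absorb1)
    then show ?thesis
      by (auto simp: in_closure_of topspace_germ_topology boundary_germs_def)
  qed
  show ?thesis
  proof (intro equalityI subsetI)
    fix c assume c: "c \<in> X_bar G E \<mu>"
    then have mem: "c \<in> boundary_germs G E" "germ_source E c = \<mu>" and
      cl: "\<And>W. openin (germ_topology G E) W \<Longrightarrow> c \<in> W \<Longrightarrow> \<exists>\<xi>\<in>boundary E. unit_germ G E \<xi> \<in> W"
      using closure by (auto simp: X_bar_def)
    obtain \<alpha> g \<beta> \<eta> where rep: "(\<alpha>, g, \<beta>, \<eta>) \<in> germ_reps G E" "c = germ G E \<alpha> g \<beta> \<eta>"
      using mem(1) germsE by (metis (no_types, lifting) boundary_germs_def mem_Collect_eq)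
    then have "\<eta> = \<mu>"
      using mem(2) germ_source_germ by simp
    have tri: "(\<alpha>, g, \<beta>) \<in> germ_triples G E"
      using rep(1) by (simp add: germ_reps_iff)
    have "\<exists>\<xi>\<in>V. germ G E \<alpha> g \<beta> \<xi> = unit_germ G E \<xi>"
      if V: "openin (path_topology E) V" "\<mu> \<in> V" "V \<subseteq> cylinder E \<beta>" for V
    proof -
      obtain \<xi> where \<xi>: "\<xi> \<in> boundary E" "unit_germ G E \<xi> \<in> germ G E \<alpha> g \<beta> ` V"
        using cl[OF openin_germ_image[OF tri V(1,3)]] V(2) rep(2) \<open>\<eta> = \<mu>\<close> by blast
      then obtain \<theta> where \<theta>: "\<theta> \<in> V" "unit_germ G E \<xi> = germ G E \<alpha> g \<beta> \<theta>"
        by blast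
      then have "(\<alpha>, g, \<beta>, \<theta>) \<in> germ_reps G E"
        using tri V(3) by (auto simp: germ_reps_def)
      then have "\<xi> = \<theta>"
        using germ_source_germ germ_source_unit_germ \<theta>(2) \<xi>(1) boundary_subset_path_space
        by (metis subsetD)
      then show ?thesis
        using \<theta> by metis
    qed
    then have "c = unit_germ G E \<mu> \<or> \<alpha> = \<beta> \<and> (\<alpha>, g) \<in> sing_decs G E \<mu>"
      using sing_dec_if_limit_of_units[of \<alpha> g \<beta> \<mu>] rep \<open>\<eta> = \<mu>\<close> by blast
    then show "c \<in> {unit_germ G E \<mu>} \<union> {germ G E \<alpha> g \<alpha> \<mu> | \<alpha> g. (\<alpha>, g) \<in> sing_decs G E \<mu>}"
      using rep(2) \<open>\<eta> = \<mu>\<close> by blast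
  next
    fix c assume "c \<in> {unit_germ G E \<mu>} \<union> {germ G E \<alpha> g \<alpha> \<mu> | \<alpha> g. (\<alpha>, g) \<in> sing_decs G E \<mu>}"
    then consider "c = unit_germ G E \<mu>"
      | \<alpha> g where "c = germ G E \<alpha> g \<alpha> \<mu>" "(\<alpha>, g) \<in> sing_decs G E \<mu>"
      by blast
    then show "c \<in> X_bar G E \<mu>"
    proof cases
      case 1
      then show ?thesis
        using assms closure unit_germ_mem_boundary_germs germ_source_unit_germ[OF \<mu>] germ_range_unit_germ[OF \<mu>]
        by (auto simp: X_bar_def)
    next
      case 2
      have "\<exists>\<xi>\<in>boundary E. unit_germ G E \<xi> \<in> W" if W: "openin (germ_topology G E) W" "c \<in> W" for W
      proof -
        \<comment> \<open>With the whole space as neighbourhood of the unit, inseparability says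
          that every neighbourhood of \<open>c\<close> contains a unit over the boundary.\<close>
        have "unit_germ G E \<mu> \<in> topspace (germ_topology G E)"
          using unit_germ_mem_germs[OF \<mu>] topspace_germ_topology by simp
        then show ?thesis
          using sing_dec_germ_inseparable[OF 2(2) \<mu> openin_topspace] W 2(1) by metis
      qed
      then show ?thesis
        using 2 closure sing_dec_germ_mem_boundary_germs[OF 2(2) \<mu>] sing_dec_germ(4)[OF 2(2) \<mu>]
        by (auto simp: X_bar_def)
    qed
  qed
qed

text \<open>
  For infinite \<open>\<mu>\<close> the equivalence of singular decompositions omits the condition
  \<open>\<alpha>(g\<alpha>') = \<beta>(h\<beta>')\<close> of the germ relation; it is automatic because prefixes of \<open>\<xi>\<close> are fixed by \<open>g\<close>.
\<close>

lemma sing_dec_rel_iff: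
  assumes "\<mu> \<in> path_space E"
  shows "((\<alpha>, g), (\<beta>, h)) \<in> sing_dec_rel G E \<mu> \<longleftrightarrow>
    (\<alpha>, g) \<in> sing_decs G E \<mu> \<and> (\<beta>, h) \<in> sing_decs G E \<mu> \<and> germ G E \<alpha> g \<alpha> \<mu> = germ G E \<beta> h \<beta> \<mu>"
proof (cases "(\<alpha>, g) \<in> sing_decs G E \<mu> \<and> (\<beta>, h) \<in> sing_decs G E \<mu>")
  case True
  then have dec: "(\<alpha>, g) \<in> sing_decs G E \<mu>" "(\<beta>, h) \<in> sing_decs G E \<mu>"
    by simp_all
  have eq: "germ G E \<alpha> g \<alpha> \<mu> = germ G E \<beta> h \<beta> \<mu> \<longleftrightarrow>
      (\<exists>\<alpha>'\<in>fin_paths E. \<exists>\<beta>'\<in>fin_paths E. composable E \<alpha> \<alpha>' \<and> composable E \<beta> \<beta>' \<and>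
        \<alpha> \<cdot> \<alpha>' = \<beta> \<cdot> \<beta>' \<and> is_prefix E (\<alpha> \<cdot> \<alpha>') \<mu> \<and>
        \<alpha> \<cdot> pact G g \<alpha>' = \<beta> \<cdot> pact G h \<beta>' \<and> pres G g \<alpha>' = pres G h \<beta>')"
    unfolding germ_eq_iff[OF sing_dec_germ(1)[OF dec(1) assms] sing_dec_germ(1)[OF dec(2) assms]]
      germ_eq_at_def prod.case by fastforce
  show ?thesis
  proof (cases "\<mu> \<in> inf_paths E")
    case inf: True
    have fixed: "pact G g \<alpha>' = \<alpha>'"
      if dec: "(\<alpha>, g) \<in> sing_decs G E \<mu>"
        and \<alpha>': "composable E \<alpha> \<alpha>'" "\<alpha>' \<in> fin_paths E" "is_prefix E (\<alpha> \<cdot> \<alpha>') \<mu>"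
      for \<alpha> \<alpha>' g
    proof -
      have "(\<alpha>, g) \<in> inf_sing_decs G E \<mu>"
        using dec inf by (simp add: sing_decs_def)
      then obtain \<zeta> where \<zeta>: "composable E \<alpha> \<zeta>" "\<mu> = \<alpha> \<cdot> \<zeta>"
          "\<forall>\<nu>. is_prefix E \<nu> \<zeta> \<longrightarrow> (\<exists>\<kappa>. fin_strongly_fixed G E g \<kappa> \<and> is_prefix E \<nu> \<kappa>)"
        by (rule mem_inf_sing_decsE)
      then show ?thesis
        using is_prefix_pconc_cancel[OF \<alpha>'(1,2) \<zeta>(1)] \<alpha>'(3) pact_fixed_prefix by blast
    qed
    have "((\<alpha>, g), (\<beta>, h)) \<in> sing_dec_rel G E \<mu> \<longleftrightarrow>
      (\<exists>\<alpha>'\<in>fin_paths E. \<exists>\<beta>'\<in>fin_paths E. composable E \<alpha> \<alpha>' \<and> composable E \<beta> \<beta>' \<and>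
        \<alpha> \<cdot> \<alpha>' = \<beta> \<cdot> \<beta>' \<and> is_prefix E (\<alpha> \<cdot> \<alpha>') \<mu> \<and> pres G g \<alpha>' = pres G h \<beta>')"
      using inf dec by (simp add: sing_dec_rel_def inf_sing_dec_rel_def sing_decs_def)
    also have "\<dots> \<longleftrightarrow> germ G E \<alpha> g \<alpha> \<mu> = germ G E \<beta> h \<beta> \<mu>"
      unfolding eq using fixed[OF dec(1)] fixed[OF dec(2)] by (intro bex_cong refl) auto
    finally show ?thesis
      using dec by simp
  next
    case False
    then show ?thesis
      using dec eq by (simp add: sing_dec_rel_def fin_sing_dec_rel_def sing_decs_def)
  qed
next
  case False
  then show ?thesis
    by (auto simp: sing_dec_rel_def inf_sing_dec_rel_def fin_sing_dec_rel_def sing_decs_def split: if_splits)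
qed

end

section \<open>Counting the isotropy elements in the closure of the units\<close>

text \<open>The classes of R are the fibres of \<open>f\<close>, one for each value.\<close>

lemma card_of_quotient_kernel:
  assumes "\<And>x y. (x, y) \<in> R \<longleftrightarrow> x \<in> A \<and> y \<in> A \<and> f x = f y"
  shows "|A // R| =o |f ` A|"
proof -
  have R: "R `` {x} = {y \<in> A. f x = f y}" if "x \<in> A" for x
    using that assms by auto
  have "inj_on (\<lambda>y. {x \<in> A. y = f x}) (f ` A)"
    by (rule inj_onI) auto
  moreover have "(\<lambda>y. {x \<in> A. y = f x}) ` f ` A = A // R"
    using R by (auto simp: quotient_def image_iff)
  ultimately have "bij_betw (\<lambda>y. {x \<in> A. y = f x}) (f ` A) (A // R)"
    by (simp add: bij_betw_def)
  then have "|f ` A| =o |A // R|"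
    by (rule card_of_ordIsoI)
  then show ?thesis
    by (rule ordIso_symmetric)
qed

text \<open>As a cardinal sum, "plus one" also makes sense for an infinite set.\<close>

lemma card_of_insert_csum:
  assumes "u \<notin> B"
  shows "|insert u B| =o |B| +c cone"
proof -
  have "bij_betw (case_sum id (\<lambda>_. u)) (B <+> {()}) (insert u B)"
    using assms by (intro bij_betwI[of _ _ _ "\<lambda>x. if x = u then Inr () else Inl x"]) auto
  then have "|B <+> {()}| =o |insert u B|"
    by (rule card_of_ordIsoI)
  then show ?thesis
    by (simp add: BNF_Cardinal_Arithmetic.csum_def BNF_Cardinal_Arithmetic.cone_def Field_card_of
        ordIso_symmetric)
qed

context self_similar_action
begin

text \<open>The map from singular decompositions to germs has the equivalence as its kernel and
  misses the unit, because the tail of a singular decomposition is not strongly fixed. The unit is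
  the summand one.\<close>

lemma card_X_bar:
  assumes "\<mu> \<in> boundary E"
  shows "|X_bar G E \<mu>| =o |sing_decs G E \<mu> // sing_dec_rel G E \<mu>| +c cone"
proof -
  have \<mu>: "\<mu> \<in> path_space E"
    using assms boundary_subset_path_space by blast
  define f where "f = (\<lambda>(\<alpha>, g). germ G E \<alpha> g \<alpha> \<mu>)"
  have X: "X_bar G E \<mu> = insert (unit_germ G E \<mu>) (f ` sing_decs G E \<mu>)"
    unfolding X_bar_eq[OF assms] f_def by force
  have "unit_germ G E \<mu> \<notin> f ` sing_decs G E \<mu>"
    using sing_dec_germ(2)[OF _ \<mu>] by (fastforce simp: f_def)
  then have "|X_bar G E \<mu>| =o |f ` sing_decs G E \<mu>| +c cone"
    unfolding X by (rule card_of_insert_csum)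
  moreover have "|sing_decs G E \<mu> // sing_dec_rel G E \<mu>| =o |f ` sing_decs G E \<mu>|"
  proof (rule card_of_quotient_kernel)
    fix x y :: "('g, 'e) path \<times> 'g"
    obtain \<alpha> g \<beta> h where "x = (\<alpha>, g)" "y = (\<beta>, h)"
      by (metis surj_pair)
    then show "(x, y) \<in> sing_dec_rel G E \<mu> \<longleftrightarrow>
        x \<in> sing_decs G E \<mu> \<and> y \<in> sing_decs G E \<mu> \<and> f x = f y"
      using sing_dec_rel_iff[OF \<mu>] by (simp add: f_def)
  qed
  then have "|f ` sing_decs G E \<mu>| +c cone =o |sing_decs G E \<mu> // sing_dec_rel G E \<mu>| +c cone"
    by (rule csum_cong1[OF ordIso_symmetric])
  ultimately show ?thesis
    by (rule ordIso_transitive)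
qed

end

theorem proposition6p19:
  fixes G :: "('g, 'e) ss_groupoid" and E :: "('g, 'e) pre_digraph"
  assumes "self_similar_action G E"
  shows "unit_germ G E ` path_space E - hausdorff_points (germ_topology G E) =
           unit_germ G E ` boundary E - hausdorff_points (boundary_germ_topology G E)
       \<and> (\<forall>\<mu>\<in>path_space E.
           unit_germ G E \<mu> \<in> unit_germ G E ` boundary E - hausdorff_points (boundary_germ_topology G E)
             \<longleftrightarrow> sing_decs G E \<mu> \<noteq> {})
       \<and> (\<forall>\<mu>\<in>boundary E.
           X_bar G E \<mu> = {unit_germ G E \<mu>} \<union> {germ G E \<alpha> g \<alpha> \<mu> | \<alpha> g. (\<alpha>, g) \<in> sing_decs G E \<mu>}
           \<and> |X_bar G E \<mu>| =o |sing_decs G E \<mu> // sing_dec_rel G E \<mu>| +c cone)"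
proof -
  interpret self_similar_action G E
    by (rule assms)
  \<comment> \<open>Paths are identified with their units; injectivity of the inclusion makes a unit
    belong to the image of the boundary only if its path does.\<close>
  have mem: "unit_germ G E \<mu> \<in> unit_germ G E ` boundary E \<longleftrightarrow> \<mu> \<in> boundary E" if "\<mu> \<in> path_space E" for \<mu>
    using inj_on_image_mem_iff[OF inj_on_unit_germ that boundary_subset_path_space] .
  have "unit_germ G E ` path_space E - hausdorff_points (germ_topology G E) =
      unit_germ G E ` boundary E - hausdorff_points (boundary_germ_topology G E)" (is "?L = ?R")
  proof -
    \<comment> \<open>Both sides are compared with a third set, the units over paths that have a
      singular decomposition.\<close>
    have "c \<in> ?L \<longleftrightarrow> (\<exists>\<mu>\<in>path_space E. c = unit_germ G E \<mu> \<and> sing_decs G E \<mu> \<noteq> {})" for c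
      using not_hausdorff_iff_sing_decs(1) by auto
    moreover have "c \<in> ?R \<longleftrightarrow> (\<exists>\<mu>\<in>path_space E. c = unit_germ G E \<mu> \<and> sing_decs G E \<mu> \<noteq> {})" for c
    proof
      assume "c \<in> ?R"
      then obtain \<mu> where \<mu>: "\<mu> \<in> boundary E" "c = unit_germ G E \<mu>"
          "unit_germ G E \<mu> \<notin> hausdorff_points (boundary_germ_topology G E)"
        by blast
      then have "\<mu> \<in> path_space E"
        using boundary_subset_path_space by blast
      then show "\<exists>\<mu>\<in>path_space E. c = unit_germ G E \<mu> \<and> sing_decs G E \<mu> \<noteq> {}"
        using not_hausdorff_iff_sing_decs(2)[of \<mu>] \<mu> by auto
    next
      assume "\<exists>\<mu>\<in>path_space E. c = unit_germ G E \<mu> \<and> sing_decs G E \<mu> \<noteq> {}"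
      then show "c \<in> ?R"
        using not_hausdorff_iff_sing_decs(2) by auto
    qed
    ultimately show ?thesis
      by (intro set_eqI) (simp only:)
  qed
  moreover have "unit_germ G E \<mu> \<in> ?R \<longleftrightarrow> sing_decs G E \<mu> \<noteq> {}" if "\<mu> \<in> path_space E" for \<mu>
    using mem[OF that] not_hausdorff_iff_sing_decs(2)[OF that] by (simp only: Diff_iff)
  ultimately show ?thesis
    using X_bar_eq card_X_bar by (intro conjI ballI)
qed

end
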